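(* Let $d\ge2$ and let $\mathbf{k}\in L^1(\mathbb{R}^d,\mathbb{R}^{d\times d})$ be of the form $\mathbf{k}(x)=k^\parallel(\|x\|)\,\mathrm{Pr}_x^\parallel+k^\perp(\|x\|)\,\mathrm{Pr}_x^\perp$ for $x\ne0$, with $k^\parallel,k^\perp:\mathbb{R}^+\to\mathbb{R}$. Then its Fourier transform is of the form $$\widehat{\mathbf{k}}(\xi)=h^\parallel(\|\xi\|)\,\mathrm{Pr}_\xi^\parallel+h^\perp(\|\xi\|)\,\mathrm{Pr}_\xi^\perp,\qquad \xi\in\mathbb{R}^d\setminus\{0\},$$ where $h^\parallel,h^\perp:\mathbb{R}^+\to\mathbb{R}$ are the functions, with $\mu:=\frac d2-1$ and $\varrho>0$, $$h^\parallel(\varrho)=\frac{2\pi}{\varrho^\mu}\int_0^\infty r^{\mu+1}k^\parallel(r)J_\mu(2\pi\varrho r)\,dr-\frac{2\mu+1}{\varrho^{\mu+1}}\int_0^\infty r^{\mu}\big(k^\parallel(r)-k^\perp(r)\big)J_{\mu+1}(2\pi\varrho r)\,dr,$$ $$h^\perp(\varrho)=\frac{2\pi}{\varrho^\mu}\int_0^\infty r^{\mu+1}k^\perp(r)J_\mu(2\pi\varrho r)\,dr+\frac{1}{\varrho^{\mu+1}}\int_0^\infty r^{\mu}\big(k^\parallel(r)-k^\perp(r)\big)J_{\mu+1}(2\pi\varrho r)\,dr.$$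
   Context: $\mathbb{R}^+=(0,\infty)$; $\|\cdot\|$ is the Euclidean norm. For $x\in\mathbb{R}^d\setminus\{0\}$, $\mathrm{Pr}_x^\parallel:=xx^T/\|x\|^2$ and $\mathrm{Pr}_x^\perp:=\mathbb{I}_d-xx^T/\|x\|^2$. The Fourier transform is taken entrywise with the convention $\widehat f(\xi)=\int_{\mathbb{R}^d}f(x)e^{-2\pi i x\cdot\xi}\,dx$. $J_\nu$ denotes the Bessel function of the first kind of order $\nu$. *)

theory Defs
  imports "HOL-Analysis.Analysis"
begin

(* Bessel function of the first kind. The power series is only intended for x > 0: powr is not the
   usual power at nonpositive arguments (in particular 0 powr 0 = 0). The reciprocal Gamma
   function rGamma is 0 at the poles of Gamma, as is customary. *)
definition bessel_J :: "real \<Rightarrow> real \<Rightarrow> real" where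
  "bessel_J \<nu> x = (\<Sum>m. (-1) ^ m / fact m * rGamma (real m + \<nu> + 1) * (x / 2) powr (2 * real m + \<nu>))"

definition Pr_par :: "real ^ 'n \<Rightarrow> real ^ 'n ^ 'n" where
  "Pr_par x = (\<chi> i j. x $ i * x $ j / (norm x)\<^sup>2)"

definition Pr_perp :: "real ^ 'n \<Rightarrow> real ^ 'n ^ 'n" where
  "Pr_perp x = mat 1 - Pr_par x"

definition fourier :: "(real ^ 'n \<Rightarrow> complex) \<Rightarrow> real ^ 'n \<Rightarrow> complex" where
  "fourier f \<xi> = (LINT x|lebesgue. f x * exp (- 2 * complex_of_real pi * \<i> * complex_of_real (x \<bullet> \<xi>)))"

definition fourier_matrix :: "(real ^ 'n \<Rightarrow> real ^ 'm ^ 'k) \<Rightarrow> real ^ 'n \<Rightarrow> complex ^ 'm ^ 'k" where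
  "fourier_matrix K \<xi> = (\<chi> i j. fourier (\<lambda>x. complex_of_real (K x $ i $ j)) \<xi>)"

definition complex_matrix :: "real ^ 'm ^ 'k \<Rightarrow> complex ^ 'm ^ 'k" where
  "complex_matrix A = (\<chi> i j. complex_of_real (A $ i $ j))"

end

theory Submission
  imports Defs "HOL-Probability.Distributions"
begin

text \<open>
  Let \<open>w\<close> be a weight on $\mathbb{R}^d$ whose integral over the ball of radius \<open>R\<close> is \<open>W R\<close>. Then the push-forward
  of \<open>w(x) dx\<close> under the norm has density \<open>W'\<close>, so \<open>\<integral> f(\<bar>x\<bar>) w(x) dx = \<integral> f(r) W'(r) dr\<close>. This is applied
  to \<open>w(x) = cos (2 \<pi> x \<bullet> \<xi>)\<close> and \<open>w(x) = (x \<bullet> v)\<^sup>2 cos (2 \<pi> x \<bullet> \<xi>)\<close>; the second one, with \<open>f(r) / r\<^sup>2\<close> in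
  place of \<open>f\<close>, yields the quadratic form of the anisotropic part of the kernel. The integrals \<open>W\<close> are found by
  expanding the cosine: the moments \<open>\<integral> (x \<bullet> \<eta>)\<^sup>2\<^sup>m dx\<close> over balls follow from the Gaussian ones, polarising
  \<open>\<eta> = \<xi> + s v\<close> supplies the factor \<open>(x \<bullet> v)\<^sup>2\<close>, and the resulting series are those of $J_\mu$ and
  $J_{\mu+1}$. Since the density of \<open>w\<close> is dominated by that of \<open>\<bar>w\<bar>\<close>, the integrability of the Bessel
  integrands requires no growth estimate for Bessel functions.
\<close>

section \<open>Radial push-forward of a density\<close>

text \<open>The hypotheses speak of \<open>K\<close> alone, as an L^1 function for the completed
  measure; the profiles come with no measurability of their own. It has to be recovered from the
  Lebesgue measurability of \<open>f (norm x)\<close>, and the push-forward under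
  \<open>norm\<close> serves there as well: for the constant weight its density is positive at all
  \<open>r > 0\<close>, so null sets of positive radii match null sets of points. Balls,
  differentiated in the radius, stand in for spheres and surface measure. Ball integrals of
  homogeneous weights are monomials in \<open>R\<close>, which leaves one constant to find; testing
  against exp(-r^2) gives it. The Gaussian moments in turn are read off from the generating function
  exp(s^2 |eta|^2 / 4). The bound d >= 2 enters twice: \<open>k_perp\<close> is extracted from the
  trace of \<open>K\<close> by dividing by d - 1, and a vector orthogonal to \<xi> isolates the
  integrand with the Bessel function of order \<mu> + 1.\<close>

lemma has_real_derivative_nonneg_of_mono:
  fixes W :: "real \<Rightarrow> real"
  assumes mono: "\<And>s. r \<le> s \<Longrightarrow> W r \<le> W s"
    and deriv: "(W has_real_derivative D) (at r)"
  shows "D \<ge> 0"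
proof (rule ccontr)
  assume "\<not> D \<ge> 0"
  \<comment> \<open>A negative derivative makes \<open>W\<close> drop just to the right of
    \<open>r\<close>. Only that side is compared, because at \<open>r = 0\<close> a ball integral
    gives monotonicity to the right alone.\<close>
  then obtain d where d: "d > 0" "\<And>h. 0 < h \<Longrightarrow> h < d \<Longrightarrow> W (r + h) < W r"
    using DERIV_neg_dec_right[OF deriv] by auto
  show False
    using d(2)[of "d / 2"] mono[of "r + d / 2"] d(1) by auto
qed

text \<open>The half-lines \<open>{..R}\<close> generate the Borel sets, and both measures give them
  mass \<open>W R\<close>: one by the ball integral, the other by the fundamental theorem of
  calculus. That \<open>W'\<close> can be a density at all follows from the monotonicity of
  \<open>W\<close> in the radius.\<close>

lemma distr_norm_density:
  fixes w :: "'a::euclidean_space \<Rightarrow> real" and W W' :: "real \<Rightarrow> real"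
  assumes [measurable]: "w \<in> borel_measurable borel" "W' \<in> borel_measurable borel"
    and nonneg: "\<And>x. w x \<ge> 0"
    and ball: "\<And>R. R \<ge> 0 \<Longrightarrow> has_bochner_integral lborel (\<lambda>x. indicator (cball 0 R) x * w x) (W R)"
    and deriv: "\<And>r. (W has_real_derivative W' r) (at r)"
  shows "distr (density lborel (\<lambda>x. ennreal (w x))) borel norm
           = density lborel (\<lambda>r. ennreal (indicator {0<..} r * W' r))"
    and "\<And>r. r \<ge> 0 \<Longrightarrow> W' r \<ge> 0"
proof -
  \<comment> \<open>The ball of radius 0 is a point, hence null; this fixes the constant of
    integration.\<close>
  have W0: "W 0 = 0"
  proof -
    have "has_bochner_integral lborel (\<lambda>x. indicator (cball 0 0) x * w x) 0"
      by (subst has_bochner_integral_cong_AE[where g = "\<lambda>_. 0"], simp, simp)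
         (rule AE_I[of _ _ "{0}"], auto split: split_indicator)
    with ball[of 0] show ?thesis
      using has_bochner_integral_eq by fastforce
  qed
  have mono: "W r \<le> W s" if "0 \<le> r" "r \<le> s" for r s
  proof -
    have "integral\<^sup>L lborel (\<lambda>x. indicator (cball 0 r) x * w x) \<le> integral\<^sup>L lborel (\<lambda>x. indicator (cball 0 s) x * w x)"
      using that nonneg ball[of r] ball[of s]
      by (intro integral_mono) (auto simp: has_bochner_integral_iff split: split_indicator)
    then show ?thesis
      using that ball[of r] ball[of s] by (auto simp: has_bochner_integral_iff)
  qed
  show pos: "W' r \<ge> 0" if "r \<ge> 0" for r
    using has_real_derivative_nonneg_of_mono[of r W, OF mono deriv] that by simp
  show "distr (density lborel (\<lambda>x. ennreal (w x))) borel norm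
           = density lborel (\<lambda>r. ennreal (indicator {0<..} r * W' r))" (is "?M = ?N")
  proof (rule measure_eqI_generator_eq[where E = "range atMost" and \<Omega> = UNIV and A = "\<lambda>n. {..real n}"])
    show "Int_stable (range (atMost :: real \<Rightarrow> _))"
      by (auto simp: Int_stable_def)
    have M: "emeasure ?M {..R} = ennreal (if R \<ge> 0 then W R else 0)" for R
    proof -
      have [measurable]: "norm -` {..R} \<in> sets (borel :: 'a measure)"
        using measurable_sets[of norm borel borel "{..R}"] by simp
      have "emeasure ?M {..R} = (\<integral>\<^sup>+x. ennreal (w x) * indicator (norm -` {..R}) x \<partial>lborel)"
        by (subst emeasure_distr) (auto simp: emeasure_density)
      also have "\<dots> = (\<integral>\<^sup>+x. ennreal (indicator (cball 0 R) x * w x) \<partial>lborel)"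
        by (intro nn_integral_cong) (auto split: split_indicator)
      also have "\<dots> = ennreal (if R \<ge> 0 then W R else 0)"
      proof (cases "R \<ge> 0")
        case True
        then show ?thesis
          using ball[of R] nonneg
          by (subst nn_integral_eq_integral) (auto simp: has_bochner_integral_iff)
      next
        case False
        then show ?thesis by simp
      qed
      finally show ?thesis .
    qed
    have N: "emeasure ?N {..R} = ennreal (if R \<ge> 0 then W R else 0)" for R
    proof (cases "R \<ge> 0")
      case True
      \<comment> \<open>\<open>V\<close> equals \<open>W'\<close> for \<open>r >= 0\<close>, where
        \<open>pos\<close> applies; the sign of \<open>W'\<close> at negative radii is
        unknown.\<close>
      define V where "V r = max 0 (W' r)" for r
      have [measurable]: "V \<in> borel_measurable borel"
        unfolding V_def by measurable
      have "emeasure ?N {..R} = (\<integral>\<^sup>+r. ennreal (indicator {0<..} r * W' r) * indicator {..R} r \<partial>lborel)"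
        by (subst emeasure_density) auto
      also have "\<dots> = (\<integral>\<^sup>+r. ennreal (V r) * indicator {0..R} r \<partial>lborel)"
        by (intro nn_integral_cong_AE AE_I[of _ _ "{0}"]) (auto simp: V_def pos split: split_indicator)
      also have "\<dots> = ennreal (W R - W 0)"
        using True pos deriv by (intro nn_integral_FTC_Icc) (auto simp: V_def)
      finally show ?thesis using True W0 by simp
    next
      case False
      then show ?thesis
        by (subst emeasure_density) (auto simp: nn_integral_0_iff_AE split: split_indicator)
    qed
    show "\<And>X. X \<in> range atMost \<Longrightarrow> emeasure ?M X = emeasure ?N X"
      using M N by auto
    show "sets ?M = sigma_sets UNIV (range atMost)" "sets ?N = sigma_sets UNIV (range atMost)"
      by (simp_all add: borel_eq_atMost)
    show "(\<Union>n. {..real n}) = UNIV" by (auto intro: real_arch_simple)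
    show "emeasure ?M {..real n} \<noteq> \<infinity>" for n by (simp add: M)
  qed auto
qed

text \<open>Integrability passes through densities and image measures in both directions, so on the
  half-line it is inherited from the space, with no estimate of \<open>W'\<close>.\<close>

lemma radial_integral_nonneg:
  fixes w :: "'a::euclidean_space \<Rightarrow> real" and f W W' :: "real \<Rightarrow> real"
  assumes [measurable]: "f \<in> borel_measurable borel" "w \<in> borel_measurable borel" "W' \<in> borel_measurable borel"
    and nonneg: "\<And>x. w x \<ge> 0"
    and ball: "\<And>R. R \<ge> 0 \<Longrightarrow> has_bochner_integral lborel (\<lambda>x. indicator (cball 0 R) x * w x) (W R)"
    and deriv: "\<And>r. (W has_real_derivative W' r) (at r)"
    and int: "integrable lborel (\<lambda>x. f (norm x) * w x)"
  shows "set_integrable lborel {0<..} (\<lambda>r. f r * W' r)"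
    and "(LINT x|lborel. f (norm x) * w x) = (LINT r:{0<..}|lborel. f r * W' r)"
proof -
  have D: "distr (density lborel (\<lambda>x. ennreal (w x))) borel norm
       = density lborel (\<lambda>r. ennreal (indicator {0<..} r * W' r))" "\<And>r. r \<ge> 0 \<Longrightarrow> W' r \<ge> 0"
    using distr_norm_density[OF assms(2-4) ball deriv] by auto
  have pos: "indicator {0<..} r * W' r \<ge> 0" for r
    using D(2)[of r] by (auto split: split_indicator)
  have "integrable (density lborel (\<lambda>x. ennreal (w x))) (\<lambda>x. f (norm x))"
    using int by (subst integrable_density) (auto simp: nonneg mult.commute)
  also have "integrable (density lborel (\<lambda>x. ennreal (w x))) (\<lambda>x. f (norm x))
      \<longleftrightarrow> integrable (distr (density lborel (\<lambda>x. ennreal (w x))) borel norm) f"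
    by (subst integrable_distr_eq) auto
  also have "integrable (distr (density lborel (\<lambda>x. ennreal (w x))) borel norm) f
      \<longleftrightarrow> integrable lborel (\<lambda>r. (indicator {0<..} r * W' r) *\<^sub>R f r)"
    unfolding D(1) by (subst integrable_density) (auto simp: pos)
  finally show "set_integrable lborel {0<..} (\<lambda>r. f r * W' r)"
    by (simp add: set_integrable_def mult_ac)
  have "(LINT x|lborel. f (norm x) * w x) = (LINT x|density lborel (\<lambda>x. ennreal (w x)). f (norm x))"
    by (subst integral_density) (auto simp: nonneg mult.commute)
  also have "\<dots> = (LINT r|distr (density lborel (\<lambda>x. ennreal (w x))) borel norm. f r)"
    by (subst integral_distr) auto
  also have "\<dots> = (LINT r:{0<..}|lborel. f r * W' r)"
    unfolding D(1) set_lebesgue_integral_def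
    by (subst integral_density, simp_all add: pos, simp add: mult_ac)
  finally show "(LINT x|lborel. f (norm x) * w x) = (LINT r:{0<..}|lborel. f r * W' r)" .
qed

text \<open>A signed \<open>w\<close> is no density; the splitting \<open>w = (b + w) - b\<close>
  has two nonnegative parts, and integrability against \<open>b\<close> covers both since
  \<open>\<bar>w x\<bar> \<le> b x\<close>.\<close>

lemma radial_integral_borel:
  fixes w b :: "'a::euclidean_space \<Rightarrow> real" and f W W' B B' :: "real \<Rightarrow> real"
  assumes [measurable]: "f \<in> borel_measurable borel"
      "w \<in> borel_measurable borel" "W' \<in> borel_measurable borel"
      "b \<in> borel_measurable borel" "B' \<in> borel_measurable borel"
    and bound: "\<And>x. \<bar>w x\<bar> \<le> b x"
    and ball: "\<And>R. R \<ge> 0 \<Longrightarrow> has_bochner_integral lborel (\<lambda>x. indicator (cball 0 R) x * w x) (W R)"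
      "\<And>R. R \<ge> 0 \<Longrightarrow> has_bochner_integral lborel (\<lambda>x. indicator (cball 0 R) x * b x) (B R)"
    and deriv: "\<And>r. (W has_real_derivative W' r) (at r)" "\<And>r. (B has_real_derivative B' r) (at r)"
    and int: "integrable lborel (\<lambda>x. f (norm x) * b x)"
  shows "set_integrable lborel {0<..} (\<lambda>r. f r * W' r)"
    and "(LINT x|lborel. f (norm x) * w x) = (LINT r:{0<..}|lborel. f r * W' r)"
proof -
  have b0: "b x \<ge> 0" "b x + w x \<ge> 0" for x using bound[of x] by linarith+
  have intw: "integrable lborel (\<lambda>x. f (norm x) * w x)"
    using bound b0
    by (intro Bochner_Integration.integrable_bound[OF int]) (auto simp: abs_mult intro!: mult_left_mono)
  have ints: "integrable lborel (\<lambda>x. f (norm x) * (b x + w x))"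
    using int intw by (simp add: distrib_left)
  have ball': "has_bochner_integral lborel (\<lambda>x. indicator (cball 0 R) x * (b x + w x)) (B R + W R)" if "R \<ge> 0" for R
    using has_bochner_integral_add[OF ball(2) ball(1)] that by (simp add: distrib_left)
  have deriv': "((\<lambda>r. B r + W r) has_real_derivative B' r + W' r) (at r)" for r
    using deriv by (intro DERIV_add)
  note b = radial_integral_nonneg[OF assms(1,4,5) b0(1) ball(2) deriv(2) int]
  note s = radial_integral_nonneg[of f "\<lambda>x. b x + w x" "\<lambda>r. B' r + W' r",
      OF _ _ _ b0(2) ball' deriv' ints, simplified]
  have eq: "f r * W' r = f r * (B' r + W' r) - f r * B' r" for r
    by (simp add: algebra_simps)
  show "set_integrable lborel {0<..} (\<lambda>r. f r * W' r)"
    unfolding eq by (intro set_integral_diff s b)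
  have "(LINT r:{0<..}|lborel. f r * W' r)
      = (LINT r:{0<..}|lborel. f r * (B' r + W' r)) - (LINT r:{0<..}|lborel. f r * B' r)"
    unfolding eq by (intro set_integral_diff s b)
  also have "\<dots> = (LINT x|lborel. f (norm x) * (b x + w x)) - (LINT x|lborel. f (norm x) * b x)"
    using s b by simp
  also have "\<dots> = (LINT x|lborel. f (norm x) * w x)"
    using int intw by (simp add: distrib_left)
  finally show "(LINT x|lborel. f (norm x) * w x) = (LINT r:{0<..}|lborel. f r * W' r)" ..
qed

section \<open>Lebesgue measurability of radial profiles\<close>

lemma null_sets_norm_vimage_iff:
  fixes N :: "real set"
  assumes [measurable]: "N \<in> sets borel"
  shows "norm -` N \<in> null_sets (lborel :: 'a::euclidean_space measure) \<longleftrightarrow> N \<inter> {0<..} \<in> null_sets lborel"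
proof -
  define d where "d = DIM('a)"
  have d: "d > 0" by (simp add: d_def)
  define c where "c = unit_ball_vol (real d)"
  have c: "c > 0" by (simp add: c_def)
  \<comment> \<open>Weight 1: the ball volumes \<open>c * R ^ d\<close> differentiate to a density
    that is positive at every \<open>r > 0\<close>, so it has the same null sets of positive radii
    as \<open>lborel\<close>.\<close>
  have "distr (density lborel (\<lambda>x::'a. ennreal 1)) borel norm
           = density lborel (\<lambda>r. ennreal (indicator {0<..} r * (c * (real d * r ^ (d - 1)))))"
  proof (rule distr_norm_density)
    show "has_bochner_integral lborel (\<lambda>x::'a. indicator (cball 0 R) x * 1) (c * R ^ d)" if "R \<ge> 0" for R
      using that by (simp add: has_bochner_integral_iff content_cball c_def d_def
          integrable_real_indicator[OF _ emeasure_lborel_cball_finite])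
    show "((\<lambda>r. c * r ^ d) has_real_derivative c * (real d * r ^ (d - 1))) (at r)" for r
      by (auto intro!: derivative_eq_intros)
  qed auto
  then have eq: "distr lborel borel (norm :: 'a \<Rightarrow> real)
           = density lborel (\<lambda>r. ennreal (indicator {0<..} r * (c * (real d * r ^ (d - 1)))))"
    by (simp add: density_1)
  have [measurable]: "norm -` N \<in> sets (borel :: 'a measure)"
    using measurable_sets[of norm borel borel N] by simp
  have "norm -` N \<in> null_sets (lborel :: 'a measure) \<longleftrightarrow> N \<in> null_sets (distr lborel borel (norm :: 'a \<Rightarrow> real))"
    by (simp add: null_sets_def emeasure_distr)
  also have "\<dots> \<longleftrightarrow> (AE r in lborel. r \<in> N \<longrightarrow> ennreal (indicator {0<..} r * (c * (real d * r ^ (d - 1)))) = 0)"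
    unfolding eq by (subst null_sets_density_iff) auto
  also have "\<dots> \<longleftrightarrow> (AE r in lborel. r \<notin> N \<inter> {0<..})"
  proof (intro AE_cong)
    fix r :: real
    have "c * (real d * r ^ (d - 1)) > 0" if "r > 0" using that c d by simp
    then show "(r \<in> N \<longrightarrow> ennreal (indicator {0<..} r * (c * (real d * r ^ (d - 1)))) = 0) \<longleftrightarrow> r \<notin> N \<inter> {0<..}"
      by (auto split: split_indicator simp: ennreal_eq_0_iff)
  qed
  also have "\<dots> \<longleftrightarrow> N \<inter> {0<..} \<in> null_sets lborel"
    by (subst AE_iff_null_sets) auto
  finally show ?thesis .
qed

text \<open>
  The norm maps the compact parts of \<open>norm -` A\<close> and of \<open>norm -` (- A)\<close> to Borel sets inside \<open>A\<close> and
  \<open>- A\<close>; these sandwich \<open>A\<close> up to a set whose preimage, and hence itself, is null.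
\<close>

lemma sets_lebesgue_norm_vimageD:
  assumes "norm -` A \<in> sets (lebesgue :: 'a::euclidean_space measure)"
  shows "A \<inter> {0<..} \<in> sets lebesgue"
proof -
  have inner: "\<exists>B \<in> sets borel. B \<subseteq> A \<and> norm -` A - norm -` B \<in> null_sets (lebesgue :: 'a measure)"
    if A: "norm -` A \<in> sets (lebesgue :: 'a measure)" for A
  proof -
    obtain C T where CT: "fsigma C" "T \<in> null_sets (lebesgue :: 'a measure)" "C \<union> T = norm -` A"
      using lebesgue_set_almost_fsigma[OF A] .
    obtain F :: "nat \<Rightarrow> 'a set" where "range F \<subseteq> Collect compact" "C = (\<Union>n. F n)"
      using CT(1)[unfolded fsigma_Union_compact] by metis
    then have F: "compact (F n)" "C = (\<Union>n. F n)" for n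
      by auto
    define B where "B = (\<Union>n. norm ` F n)"
    have "compact (norm ` F n)" for n
      using F(1) by (intro compact_continuous_image continuous_intros)
    then have B: "B \<in> sets borel"
      unfolding B_def by (intro sets.countable_UN) (auto intro: borel_compact)
    have BA: "B \<subseteq> A" using CT(3) F(2) by (auto simp: B_def)
    have [measurable]: "norm -` B \<in> sets (borel :: 'a measure)"
      using measurable_sets[of norm borel borel B] B by simp
    have "norm -` A - norm -` B \<subseteq> T" using CT(3) F(2) by (auto simp: B_def)
    moreover have "norm -` A - norm -` B \<in> sets (lebesgue :: 'a measure)"
      using A by (intro sets.Diff) auto
    ultimately have "norm -` A - norm -` B \<in> null_sets (lebesgue :: 'a measure)"
      using CT(2) by (meson null_sets_subset)
    with B BA show ?thesis by blast
  qed
  have "norm -` (- A) \<in> sets (lebesgue :: 'a measure)"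
    using sets.compl_sets[OF assms] by (simp add: vimage_Diff Compl_eq_Diff_UNIV)
  from inner[OF this] obtain B' where
    B': "B' \<in> sets borel" "B' \<subseteq> - A" "norm -` (- A) - norm -` B' \<in> null_sets (lebesgue :: 'a measure)"
    by (elim bexE conjE)
  from inner[OF assms] obtain B where
    B: "B \<in> sets borel" "B \<subseteq> A" "norm -` A - norm -` B \<in> null_sets (lebesgue :: 'a measure)"
    by (elim bexE conjE)
  \<comment> \<open>\<open>N\<close> is the gap between the two Borel sets, and its preimage is the
    union of the two null remainders. Only positive radii are controlled, as \<open>norm\<close>
    does not see the negative ones.\<close>
  define N where "N = - (B \<union> B')"
  have N: "N \<in> sets borel" using B(1) B'(1) by (auto simp: N_def)
  have "norm -` N \<in> sets (borel :: 'a measure)"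
    using measurable_sets[of norm borel borel N] N by simp
  moreover have "norm -` N = (norm -` A - norm -` B) \<union> (norm -` (- A) - norm -` B')"
    using B(2) B'(2) by (auto simp: N_def)
  then have "norm -` N \<in> null_sets (lebesgue :: 'a measure)"
    using B(3) B'(3) by (metis null_sets.Un)
  ultimately have "norm -` N \<in> null_sets (lborel :: 'a measure)"
    by (simp add: null_sets_def)
  then have "N \<inter> {0<..} \<in> null_sets lborel"
    using null_sets_norm_vimage_iff[OF N] by blast
  then have "(A - B) \<inter> {0<..} \<in> sets lebesgue"
    using B'(2) by (intro null_sets_completion_subset[of _ "N \<inter> {0<..}", THEN null_setsD2]) (auto simp: N_def intro: null_sets_completionI)
  moreover have "B \<inter> {0<..} \<in> sets lebesgue" using B(1) by auto
  moreover have "A \<inter> {0<..} = (A - B) \<inter> {0<..} \<union> B \<inter> {0<..}" using B(2) by auto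
  ultimately show ?thesis by (metis sets.Un)
qed

text \<open>Cut off to 0 at nonpositive radii, the profile is Lebesgue measurable on the line and so
  has a Borel representative; null sets of radii pull back to null sets of points, which carries the
  equality to space. This makes the push-forward, stated for Borel integrands, available to a
  profile known only through \<open>f (norm x)\<close>.\<close>

lemma radial_lebesgue_measurable_AE_eq_borel:
  fixes f :: "real \<Rightarrow> real"
  assumes f: "(\<lambda>x::'a::euclidean_space. f (norm x)) \<in> borel_measurable lebesgue"
  obtains g where "g \<in> borel_measurable borel"
    "AE x in (lborel :: 'a measure). f (norm x) = g (norm x)"
    "AE r in lborel. r > 0 \<longrightarrow> f r = g r"
    "(\<lambda>r. if r > 0 then f r else 0) \<in> borel_measurable lebesgue"
proof -
  define h where "h r = (if r > 0 then f r else 0)" for r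
  have h: "h \<in> borel_measurable lebesgue"
  proof (rule borel_measurableI)
    fix S :: "real set" assume "open S"
    then have "norm -` (f -` S) \<in> sets (lebesgue :: 'a measure)"
      using measurable_sets[OF f, of S] by (simp add: vimage_def)
    then have "f -` S \<inter> {0<..} \<in> sets lebesgue"
      by (rule sets_lebesgue_norm_vimageD)
    moreover have "h -` S \<inter> space lebesgue = f -` S \<inter> {0<..} \<union> (if 0 \<in> S then {..0} else {})"
      by (auto simp: h_def split: if_splits)
    ultimately show "h -` S \<inter> space lebesgue \<in> sets lebesgue"
      by auto
  qed
  then obtain g where g: "g \<in> borel_measurable lborel" "AE r in lborel. h r = g r"
    using completion_ex_borel_measurable_real by blast
  obtain N where "\<And>r. r \<in> space lborel - N \<Longrightarrow> h r = g r" "N \<in> null_sets lborel"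
    by (rule AE_E3[OF g(2)]) blast
  then have N: "N \<in> null_sets lborel" "\<And>r. r \<notin> N \<Longrightarrow> h r = g r"
    by auto
  have "AE r in lborel. r > 0 \<longrightarrow> f r = g r"
    using g(2) by eventually_elim (auto simp: h_def)
  moreover have "AE x in (lborel :: 'a measure). f (norm x) = g (norm x)"
  proof (rule AE_I')
    \<comment> \<open>The radius 0 joins the exceptional set because \<open>h 0 = 0\<close> while
      \<open>f 0\<close> is arbitrary.\<close>
    have "N \<union> {0} \<in> sets borel" using N by auto
    moreover have "(N \<union> {0}) \<inter> {0<..} \<in> null_sets lborel"
      using N by (metis (no_types) null_set_Int2 null_sets.Un greaterThan_borel finite_imp_null_set_lborel finite.emptyI finite.insertI sets_lborel)
    ultimately show "norm -` (N \<union> {0}) \<in> null_sets (lborel :: 'a measure)"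
      using null_sets_norm_vimage_iff by blast
    show "{x \<in> space (lborel :: 'a measure). f (norm x) \<noteq> g (norm x)} \<subseteq> norm -` (N \<union> {0})"
    proof
      fix x :: 'a assume "x \<in> {x \<in> space lborel. f (norm x) \<noteq> g (norm x)}"
      then show "x \<in> norm -` (N \<union> {0})"
        using N(2)[of "norm x"] by (cases "x = 0") (auto simp: h_def)
    qed
  qed
  ultimately show thesis
    using that g(1) h by (simp add: h_def[abs_def])
qed

text \<open>The Borel version holds for the representative \<open>g\<close> and is carried over to
  \<open>f\<close> along two almost-everywhere equalities, one in space and one on the
  half-line.\<close>

lemma radial_integral:
  fixes w b :: "'a::euclidean_space \<Rightarrow> real" and f W W' B B' :: "real \<Rightarrow> real"
  assumes [measurable]: "w \<in> borel_measurable borel" "W' \<in> borel_measurable borel"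
      "b \<in> borel_measurable borel" "B' \<in> borel_measurable borel"
    and bound: "\<And>x. \<bar>w x\<bar> \<le> b x"
    and ball: "\<And>R. R \<ge> 0 \<Longrightarrow> has_bochner_integral lborel (\<lambda>x. indicator (cball 0 R) x * w x) (W R)"
      "\<And>R. R \<ge> 0 \<Longrightarrow> has_bochner_integral lborel (\<lambda>x. indicator (cball 0 R) x * b x) (B R)"
    and deriv: "\<And>r. (W has_real_derivative W' r) (at r)" "\<And>r. (B has_real_derivative B' r) (at r)"
    and f: "(\<lambda>x::'a. f (norm x)) \<in> borel_measurable lebesgue"
    and int: "integrable lebesgue (\<lambda>x. f (norm x) * b x)"
  shows "set_integrable lebesgue {0<..} (\<lambda>r. f r * W' r)"
    and "(LINT x|lebesgue. f (norm x) * w x) = (LINT r:{0<..}|lebesgue. f r * W' r)"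
proof -
  obtain g where [measurable]: "g \<in> borel_measurable borel"
    and g: "AE x in (lborel :: 'a measure). f (norm x) = g (norm x)" "AE r in lborel. r > 0 \<longrightarrow> f r = g r"
    and h: "(\<lambda>r. if r > 0 then f r else 0) \<in> borel_measurable lebesgue"
    using radial_lebesgue_measurable_AE_eq_borel[OF f] .
  have fw: "(\<lambda>x. f (norm x) * w x) \<in> borel_measurable lebesgue"
    using f by (intro borel_measurable_times) (auto intro: measurable_completion)
  have AEx: "AE x in lebesgue. f (norm x) * w x = g (norm x) * w x"
      "AE x in lebesgue. f (norm x) * b x = g (norm x) * b x"
    using AE_completion[OF g(1)] by (eventually_elim, simp)+
  have AEr: "AE r in lebesgue. indicator {0<..} r *\<^sub>R (f r * W' r) = indicator {0<..} r *\<^sub>R (g r * W' r)"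
    using AE_completion[OF g(2)] by eventually_elim (auto split: split_indicator)
  have gW: "(\<lambda>r. indicator {0<..} r *\<^sub>R (g r * W' r)) \<in> borel_measurable lborel"
    by measurable
  have "(\<lambda>r. (if r > 0 then f r else 0) * W' r) \<in> borel_measurable lebesgue"
    by (intro borel_measurable_times h measurable_completion) simp
  also have "(\<lambda>r. (if r > 0 then f r else 0) * W' r) = (\<lambda>r. indicator {0<..} r *\<^sub>R (f r * W' r))"
    by (auto split: split_indicator)
  finally have fW: "(\<lambda>r. indicator {0<..} r *\<^sub>R (f r * W' r)) \<in> borel_measurable lebesgue" .

  have "integrable lebesgue (\<lambda>x. g (norm x) * b x)"
    using int by (rule integrable_cong_AE_imp) (use AEx(2) in \<open>auto intro!: measurable_completion\<close>)
  then have intg: "integrable lborel (\<lambda>x. g (norm x) * b x)"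
    by (subst (asm) integrable_completion) auto
  note G = radial_integral_borel[OF _ assms(1-9) intg, simplified]
  show "set_integrable lebesgue {0<..} (\<lambda>r. f r * W' r)"
    unfolding set_integrable_def
    by (rule integrable_cong_AE_imp[where g = "\<lambda>r. indicator {0<..} r *\<^sub>R (g r * W' r)"])
       (use G(1) AEr fW in \<open>auto simp: integrable_completion set_integrable_def\<close>)
  have "(LINT x|lebesgue. f (norm x) * w x) = (LINT x|lebesgue. g (norm x) * w x)"
    using AEx(1) fw by (intro integral_cong_AE) (auto intro!: measurable_completion)
  also have "\<dots> = (LINT r:{0<..}|lborel. g r * W' r)"
    using G(2) by (simp add: integral_completion)
  also have "\<dots> = (LINT r:{0<..}|lebesgue. g r * W' r)"
    unfolding set_lebesgue_integral_def by (simp add: integral_completion)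
  also have "\<dots> = (LINT r:{0<..}|lebesgue. f r * W' r)"
    unfolding set_lebesgue_integral_def
    using AEr fW gW by (intro integral_cong_AE) (auto intro!: measurable_completion)
  finally show "(LINT x|lebesgue. f (norm x) * w x) = (LINT r:{0<..}|lebesgue. f r * W' r)" .
qed

section \<open>Moments of balls\<close>

lemma power_series_zero_constant_coeff:
  fixes c :: "nat \<Rightarrow> real"
  assumes "\<And>u. u > 0 \<Longrightarrow> (\<lambda>n. c n * u ^ n) sums 0"
  shows "c 0 = 0"
proof -
  define F where "F u = (\<Sum>n. c n * u ^ n)" for u
  have "(\<lambda>n. c n * u ^ n) sums F u" for u
  proof -
    have "summable (\<lambda>n. c n * (\<bar>u\<bar> + 1) ^ n)"
      using assms[of "\<bar>u\<bar> + 1"] by (auto simp: sums_iff)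
    then have "summable (\<lambda>n. c n * u ^ n)"
      by (rule powser_inside) simp
    then show ?thesis by (simp add: F_def summable_sums)
  qed
  then have "(F \<longlongrightarrow> c 0) (at 0)"
    by (intro powser_limit_0[of 1]) auto
  then have "(F \<longlongrightarrow> c 0) (at_right 0)"
    by (rule filterlim_mono) (auto simp: at_le)
  moreover have "eventually (\<lambda>u. F u = 0) (at_right 0)"
    using assms by (intro eventually_at_rightI[of 0 1]) (auto simp: F_def sums_iff)
  then have "(F \<longlongrightarrow> 0) (at_right 0)"
    by (rule tendsto_eventually)
  ultimately show ?thesis
    using tendsto_unique[OF trivial_limit_at_right_real] by blast
qed

text \<open>The coefficients vanish one after another, by continuity at 0 and division by
  \<open>u\<close>. Only \<open>u > 0\<close> is available, since \<open>u\<close> will stand for a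
  square \<open>s^2\<close>.\<close>

lemma power_series_zero_coeff:
  fixes c :: "nat \<Rightarrow> real"
  assumes "\<And>u. u > 0 \<Longrightarrow> (\<lambda>n. c n * u ^ n) sums 0"
  shows "c n = 0"
  using assms
proof (induction n arbitrary: c)
  case (0 c)
  then show ?case by (rule power_series_zero_constant_coeff)
next
  case (Suc n c)
  show ?case
  proof (rule Suc.IH)
    fix u :: real assume u: "u > 0"
    have "(\<lambda>n. c (Suc n) * u ^ Suc n) sums 0"
      using Suc.prems[OF u] power_series_zero_constant_coeff[OF Suc.prems] by (subst sums_Suc_iff) simp
    from sums_divide[OF this, of u] show "(\<lambda>n. c (Suc n) * u ^ n) sums 0"
      using u by simp
  qed
qed

text \<open>Completing the square: c t - t^2 = c^2 / 4 - (t - c / 2)^2.\<close>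

lemma gaussian_exp_real:
  "(\<integral>\<^sup>+t. ennreal (exp (c * t - t\<^sup>2)) \<partial>lborel) = ennreal (sqrt pi * exp (c\<^sup>2 / 4))"
proof -
  have "has_bochner_integral lborel (\<lambda>x::real. exp (- x\<^sup>2)) (sqrt pi)"
    using has_bochner_integral_even_function[OF gaussian_moment_0] by simp
  then have "has_bochner_integral lborel (\<lambda>x::real. exp (- (- c / 2 + 1 * x)\<^sup>2)) (sqrt pi)"
    by (subst (asm) lborel_has_bochner_integral_real_affine_iff[where c = 1 and t = "- c / 2"]) simp_all
  then have "has_bochner_integral lborel (\<lambda>x::real. exp (c\<^sup>2 / 4) * exp (- (- c / 2 + 1 * x)\<^sup>2)) (exp (c\<^sup>2 / 4) * sqrt pi)"
    by (intro has_bochner_integral_mult_right)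
  moreover have "exp (c\<^sup>2 / 4) * exp (- (- c / 2 + 1 * x)\<^sup>2) = exp (c * x - x\<^sup>2)" for x
    by (simp add: exp_add[symmetric] power2_eq_square field_simps)
  ultimately have "has_bochner_integral lborel (\<lambda>x. exp (c * x - x\<^sup>2)) (exp (c\<^sup>2 / 4) * sqrt pi)"
    by (simp only:)
  then show ?thesis
    by (subst nn_integral_eq_integral) (auto simp: has_bochner_integral_iff)
qed

lemma gaussian_exp:
  fixes \<eta> :: "'a::euclidean_space"
  shows "(\<integral>\<^sup>+x. ennreal (exp (x \<bullet> \<eta>) * exp (- (norm x)\<^sup>2)) \<partial>lborel)
           = ennreal (pi powr (DIM('a) / 2) * exp ((norm \<eta>)\<^sup>2 / 4))"
proof -
  have "exp (x \<bullet> \<eta>) * exp (- (norm x)\<^sup>2) = (\<Prod>b\<in>Basis. exp ((\<eta> \<bullet> b) * (x \<bullet> b) - (x \<bullet> b)\<^sup>2))" for x :: 'a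
  proof -
    have "x \<bullet> \<eta> + - (norm x)\<^sup>2 = (\<Sum>b\<in>Basis. (\<eta> \<bullet> b) * (x \<bullet> b) - (x \<bullet> b)\<^sup>2)"
      unfolding power2_norm_eq_inner
      by (simp add: euclidean_inner[of x x] euclidean_inner[of x \<eta>] sum_subtractf power2_eq_square mult.commute)
    then show ?thesis by (simp add: exp_add[symmetric] exp_sum)
  qed
  then have "(\<integral>\<^sup>+x. ennreal (exp (x \<bullet> \<eta>) * exp (- (norm x)\<^sup>2)) \<partial>lborel)
      = (\<integral>\<^sup>+x. (\<Prod>b\<in>Basis. ennreal (exp ((\<eta> \<bullet> b) * (x \<bullet> b) - (x \<bullet> b)\<^sup>2))) \<partial>lborel)"
    by (simp add: prod_ennreal)
  also have "\<dots> = (\<Prod>b\<in>Basis. ennreal (sqrt pi * exp ((\<eta> \<bullet> b)\<^sup>2 / 4)))"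
    by (subst nn_integral_lborel_prod) (auto simp: gaussian_exp_real)
  also have "\<dots> = ennreal (\<Prod>b\<in>(Basis::'a set). sqrt pi * exp ((\<eta> \<bullet> b)\<^sup>2 / 4))"
    by (simp add: prod_ennreal)
  also have "(\<Prod>b\<in>(Basis::'a set). sqrt pi * exp ((\<eta> \<bullet> b)\<^sup>2 / 4)) = sqrt pi ^ DIM('a) * exp ((norm \<eta>)\<^sup>2 / 4)"
    unfolding power2_norm_eq_inner
    by (simp add: prod.distrib exp_sum[symmetric] euclidean_inner[of \<eta> \<eta>] sum_divide_distrib power2_eq_square)
  also have "sqrt pi ^ DIM('a) = pi powr (DIM('a) / 2)"
    by (simp add: powr_half_sqrt[symmetric] powr_powr flip: powr_realpow)
  finally show ?thesis .
qed

lemma cosh_paired: "(\<lambda>m. x ^ (2 * m) / fact (2 * m)) sums cosh (x :: real)"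
proof -
  have "(\<lambda>m. (if even (2 * m) then x ^ (2 * m) /\<^sub>R fact (2 * m) else 0)) sums cosh x"
    using cosh_converges[of x]
    by (subst sums_mono_reindex[where f = "\<lambda>n. if even n then x ^ n /\<^sub>R fact n else 0" and g = "\<lambda>m. 2 * m"])
       (auto simp: strict_mono_def elim!: evenE)
  then show ?thesis
    by (simp add: field_simps)
qed

text \<open>Averaging over \<eta> and -\<eta> replaces exp by cosh, whose series has nonnegative
  terms only; sum and integral can then be exchanged in the extended reals before any moment is
  known to be finite. Comparing the coefficients of \<open>u = s^2\<close> with those of the
  exponential series yields the moments.\<close>

lemma gaussian_moment_inner:
  fixes \<eta> :: "'a::euclidean_space"
  shows "has_bochner_integral lborel (\<lambda>x. exp (- (norm x)\<^sup>2) * (x \<bullet> \<eta>) ^ (2 * m))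
     (pi powr (DIM('a) / 2) * (fact (2 * m) / (4 ^ m * fact m)) * norm \<eta> ^ (2 * m))"
proof -
  define P where "P = pi powr (DIM('a) / 2)"
  define I where "I m = (\<integral>\<^sup>+x. ennreal (exp (- (norm x)\<^sup>2) * (x \<bullet> \<eta>) ^ (2 * m)) \<partial>lborel)" for m
  have sum: "(\<Sum>m. ennreal (s ^ (2 * m) / fact (2 * m)) * I m) = ennreal (P * exp (s\<^sup>2 * ((norm \<eta>)\<^sup>2 / 4)))" for s :: real
  proof -
    have "(\<Sum>m. ennreal (s ^ (2 * m) / fact (2 * m)) * I m)
        = (\<Sum>m. \<integral>\<^sup>+x. ennreal ((x \<bullet> (s *\<^sub>R \<eta>)) ^ (2 * m) / fact (2 * m) * exp (- (norm x)\<^sup>2)) \<partial>lborel)"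
      unfolding I_def
      by (subst nn_integral_cmult[symmetric])
         (auto simp: power_mult_distrib mult_ac ennreal_mult'[symmetric] zero_le_even_power)
    also have "\<dots> = (\<integral>\<^sup>+x. (\<Sum>m. ennreal ((x \<bullet> (s *\<^sub>R \<eta>)) ^ (2 * m) / fact (2 * m) * exp (- (norm x)\<^sup>2))) \<partial>lborel)"
      by (rule nn_integral_suminf[symmetric]) simp
    also have "\<dots> = (\<integral>\<^sup>+x. ennreal (cosh (x \<bullet> (s *\<^sub>R \<eta>)) * exp (- (norm x)\<^sup>2)) \<partial>lborel)"
    proof (intro nn_integral_cong)
      fix x :: 'a
      let ?t = "x \<bullet> (s *\<^sub>R \<eta>)"
      have "(\<lambda>m. ?t ^ (2 * m) / fact (2 * m) * exp (- (norm x)\<^sup>2)) sums (cosh ?t * exp (- (norm x)\<^sup>2))"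
        by (intro sums_mult2 cosh_paired)
      then show "(\<Sum>m. ennreal (?t ^ (2 * m) / fact (2 * m) * exp (- (norm x)\<^sup>2))) = ennreal (cosh ?t * exp (- (norm x)\<^sup>2))"
        by (intro sums_unique[symmetric]) (subst sums_ennreal, auto simp: zero_le_even_power cosh_real_nonneg)
    qed
    finally have S: "(\<Sum>m. ennreal (s ^ (2 * m) / fact (2 * m)) * I m)
        = (\<integral>\<^sup>+x. ennreal (cosh (x \<bullet> (s *\<^sub>R \<eta>)) * exp (- (norm x)\<^sup>2)) \<partial>lborel)" .
    define h :: real where "h = 1 / 2"
    have h: "h \<ge> 0" by (simp add: h_def)
    note S
    also have "(\<integral>\<^sup>+x. ennreal (cosh (x \<bullet> (s *\<^sub>R \<eta>)) * exp (- (norm x)\<^sup>2)) \<partial>lborel)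
      = (\<integral>\<^sup>+x. ennreal h * ennreal (exp (x \<bullet> (s *\<^sub>R \<eta>)) * exp (- (norm x)\<^sup>2))
         + ennreal h * ennreal (exp (x \<bullet> (- s *\<^sub>R \<eta>)) * exp (- (norm x)\<^sup>2)) \<partial>lborel)"
      by (intro nn_integral_cong)
         (use h in \<open>simp add: cosh_def ennreal_mult'[symmetric] ennreal_plus[symmetric] del: ennreal_plus\<close>,
          simp add: h_def field_simps)
    also have "\<dots> = ennreal h * ennreal (P * exp (s\<^sup>2 * ((norm \<eta>)\<^sup>2 / 4))) + ennreal h * ennreal (P * exp (s\<^sup>2 * ((norm \<eta>)\<^sup>2 / 4)))"
      by (simp add: nn_integral_add nn_integral_cmult gaussian_exp[of "s *\<^sub>R \<eta>", simplified]
            gaussian_exp[of "- s *\<^sub>R \<eta>", simplified] P_def power_mult_distrib)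
    also have "\<dots> = ennreal (h * (P * exp (s\<^sup>2 * ((norm \<eta>)\<^sup>2 / 4))) + h * (P * exp (s\<^sup>2 * ((norm \<eta>)\<^sup>2 / 4))))"
      using h by (simp add: ennreal_mult'[symmetric] ennreal_plus[symmetric] P_def del: ennreal_plus)
    also have "h * (P * exp (s\<^sup>2 * ((norm \<eta>)\<^sup>2 / 4))) + h * (P * exp (s\<^sup>2 * ((norm \<eta>)\<^sup>2 / 4))) = P * exp (s\<^sup>2 * ((norm \<eta>)\<^sup>2 / 4))"
      by (simp add: h_def)
    finally show ?thesis .
  qed
  \<comment> \<open>At \<open>s = 1\<close> each single term is bounded by the finite total.\<close>
  have fin: "I m < \<infinity>" for m
  proof -
    have "ennreal (1 ^ (2 * m) / fact (2 * m)) * I m \<le> (\<Sum>m. ennreal (1 ^ (2 * m) / fact (2 * m)) * I m)"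
      by (rule sum_le_suminf[where I = "{m}", simplified]) auto
    also have "\<dots> < \<infinity>" unfolding sum by simp
    finally show ?thesis
      by (cases "I m") (auto simp: ennreal_mult_top)
  qed
  define J where "J m = enn2real (I m)" for m
  have J: "I m = ennreal (J m)" "J m \<ge> 0" for m
    using fin[of m] by (auto simp: J_def)
  have "(\<lambda>m. (J m / fact (2 * m) - P * ((norm \<eta>)\<^sup>2 / 4) ^ m / fact m) * u ^ m) sums 0" if "u > 0" for u
  proof -
    define s where "s = sqrt u"
    have s: "s ^ (2 * m) = u ^ m" "s\<^sup>2 = u" for m using that by (simp_all add: s_def power_mult)
    have "ennreal (s ^ (2 * m) / fact (2 * m)) * I m = ennreal (s ^ (2 * m) / fact (2 * m) * J m)" for m
      by (simp only: J(1) ennreal_mult''[OF J(2), symmetric])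
    then have "(\<lambda>m. ennreal (s ^ (2 * m) / fact (2 * m) * J m)) sums ennreal (P * exp (s\<^sup>2 * ((norm \<eta>)\<^sup>2 / 4)))"
      using sum[of s] summableI by (simp add: sums_iff)
    then have "(\<lambda>m. s ^ (2 * m) / fact (2 * m) * J m) sums (P * exp (s\<^sup>2 * ((norm \<eta>)\<^sup>2 / 4)))"
      by (subst (asm) sums_ennreal) (auto simp: J zero_le_even_power P_def)
    moreover have "(\<lambda>m. P * ((u * ((norm \<eta>)\<^sup>2 / 4)) ^ m /\<^sub>R fact m)) sums (P * exp (u * ((norm \<eta>)\<^sup>2 / 4)))"
      by (intro sums_mult exp_converges)
    ultimately have "(\<lambda>m. s ^ (2 * m) / fact (2 * m) * J m - P * ((u * ((norm \<eta>)\<^sup>2 / 4)) ^ m /\<^sub>R fact m)) sums 0"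
      using sums_diff s by fastforce
    moreover have "s ^ (2 * m) / fact (2 * m) * J m - P * ((u * ((norm \<eta>)\<^sup>2 / 4)) ^ m /\<^sub>R fact m)
        = (J m / fact (2 * m) - P * ((norm \<eta>)\<^sup>2 / 4) ^ m / fact m) * u ^ m" for m
      unfolding s power_mult_distrib by (simp add: field_simps)
    ultimately show ?thesis by simp
  qed
  have E: "((norm \<eta>)\<^sup>2 / 4) ^ m = norm \<eta> ^ (2 * m) / 4 ^ m"
    by (simp only: power_divide power_mult)
  from power_series_zero_coeff[OF \<open>\<And>u. u > 0 \<Longrightarrow> _\<close>, of m]
  have "J m = P * (fact (2 * m) / (4 ^ m * fact m)) * norm \<eta> ^ (2 * m)"
    unfolding E times_divide_eq_right by (simp add: field_simps)
  then show ?thesis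
    using J[of m] unfolding I_def P_def
    by (intro has_bochner_integral_nn_integral) (auto simp: zero_le_even_power)
qed

lemma Gamma_half_plus_nat: "Gamma (real k + 1 / 2) = sqrt pi * (fact (2 * k) / (4 ^ k * fact k))"
proof (induction k)
  case 0
  show ?case by (simp add: Gamma_one_half_real)
next
  case (Suc k)
  have "Gamma (real (Suc k) + 1 / 2) = (real k + 1 / 2) * Gamma (real k + 1 / 2)"
    using Gamma_plus1[of "real k + 1 / 2"] nonpos_Ints_nonpos[of "real k + 1 / 2"]
    by (fastforce simp: add_ac)
  also have "\<dots> = (real k + 1 / 2) * (sqrt pi * (fact (2 * k) / (4 ^ k * fact k)))"
    by (simp only: Suc.IH)
  also have "\<dots> = sqrt pi * (fact (2 * Suc k) / (4 ^ Suc k * fact (Suc k)))"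
    by (simp add: divide_simps) (simp add: algebra_simps)
  finally show ?case .
qed

text \<open>The value is Euler's integral after t = r^2. Odd \<open>n\<close> gives half-integer
  arguments of Gamma, even \<open>n\<close> integer ones, and each case is a known Gaussian
  moment.\<close>

lemma gaussian_moment_half_line:
  assumes "n > 0"
  shows "(LINT r:{0<..}|lborel. exp (- r\<^sup>2) * r ^ (n - 1)) = Gamma (real n / 2) / 2"
proof -
  have eq: "(LINT r:{0<..}|(lborel :: real measure). exp (- r\<^sup>2) * r ^ (n - 1)) = (LINT r|lborel. indicator {0..} r *\<^sub>R (exp (- r\<^sup>2) * r ^ (n - 1)))"
    unfolding set_lebesgue_integral_def
  proof (rule integral_cong_AE)
    have "AE r in lborel. r \<noteq> (0::real)" by (rule AE_lborel_singleton)
    then show "AE r::real in lborel. indicator {0<..} r *\<^sub>R (exp (- r\<^sup>2) * r ^ (n - 1))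
        = indicator {0..} r *\<^sub>R (exp (- r\<^sup>2) * r ^ (n - 1))"
      by (rule AE_mp) (auto intro!: AE_I2 simp: indicator_def less_le)
  qed measurable
  show ?thesis
  proof (cases "odd n")
    case True
    then obtain k where k: "n = 2 * k + 1" by (auto elim: oddE)
    have "real n / 2 = real k + 1 / 2" using k by simp
    then have "Gamma (real n / 2) = sqrt pi * (fact (2 * k) / (4 ^ k * fact k))"
      by (simp only: Gamma_half_plus_nat)
    then show ?thesis
      unfolding eq using gaussian_moment_even_pos[of k] k
      by (simp add: has_bochner_integral_iff power_mult)
  next
    case False
    then obtain k where k: "n = 2 * k + 2"
      using assms by (metis Suc_pred add_2_eq_Suc' evenE mult_Suc_right nat_0_less_mult_iff add.commute)
    have "real n / 2 = 1 + real k" using k by simp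
    then have "Gamma (real n / 2) = fact k"
      by (simp only: Gamma_fact)
    then show ?thesis
      unfolding eq using gaussian_moment_odd_pos[of k] k
      by (simp add: has_bochner_integral_iff)
  qed
qed

lemma integrable_indicator_cball:
  fixes f :: "'a::euclidean_space \<Rightarrow> real"
  assumes "continuous_on (cball c R) f"
  shows "integrable lborel (\<lambda>x. indicator (cball c R) x * f x)"
  using borel_integrable_compact[OF compact_cball assms] by simp

text \<open>By scaling, the integral is \<open>a * R ^ n\<close> with \<open>n\<close> the dimension
  plus \<open>2 m\<close>, so only \<open>a\<close> is unknown. Integrating exp(-r^2) against the
  radial density \<open>a n r^(n - 1)\<close> must return the Gaussian moment, which determines
  \<open>a * Gamma (n / 2 + 1)\<close>.\<close>

lemma ball_moment:
  fixes \<eta> :: "'a::euclidean_space"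
  assumes "R \<ge> 0"
  shows "has_bochner_integral lborel (\<lambda>x. indicator (cball 0 R) x * (x \<bullet> \<eta>) ^ (2 * m))
     (pi powr (DIM('a) / 2) * (fact (2 * m) / (4 ^ m * fact m)) * rGamma (DIM('a) / 2 + m + 1)
        * norm \<eta> ^ (2 * m) * R ^ (DIM('a) + 2 * m))"
proof -
  define n where "n = DIM('a) + 2 * m"
  have n: "n > 0" by (simp add: n_def)
  have int: "integrable lborel (\<lambda>x. indicator (cball 0 R) x * (x \<bullet> \<eta>) ^ (2 * m))" for R
    by (auto intro!: integrable_indicator_cball continuous_intros)
  define a where "a = (LINT x|lborel. indicator (cball 0 1) x * (x \<bullet> \<eta>) ^ (2 * m))"
  have ball: "has_bochner_integral lborel (\<lambda>x. indicator (cball 0 R) x * (x \<bullet> \<eta>) ^ (2 * m)) (a * R ^ n)" if "R \<ge> 0" for R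
  proof (cases "R = 0")
    \<comment> \<open>Scaling by \<open>R\<close> fails at radius 0; there both sides vanish, as
      \<open>n > 0\<close>.\<close>
    case True
    have "(LINT x|lborel. indicator (cball 0 R) x * (x \<bullet> \<eta>) ^ (2 * m)) = (LINT x|(lborel::'a measure). 0)"
      using True by (intro integral_cong_AE AE_I[of _ _ "{0}"]) (auto split: split_indicator)
    then show ?thesis using True int[of 0] n by (simp add: has_bochner_integral_iff)
  next
    case False
    then have R: "R > 0" using that by simp
    have "(LINT x|lborel. indicator (cball 0 R) x * (x \<bullet> \<eta>) ^ (2 * m))
        = (LINT x|density (distr lborel borel (\<lambda>x::'a. 0 + R *\<^sub>R x)) (\<lambda>_. ennreal (\<bar>R\<bar> ^ DIM('a))). indicator (cball 0 R) x * (x \<bullet> \<eta>) ^ (2 * m))"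
      using lborel_affine[of R "0::'a"] R by (simp add: ennreal_power)
    also have "\<dots> = (LINT x|lborel. R ^ DIM('a) * (indicator (cball 0 R) (R *\<^sub>R x) * ((R *\<^sub>R x) \<bullet> \<eta>) ^ (2 * m)))"
      using R borel_measurable_integrable[OF int[of R]]
      by (subst integral_density) (auto simp: integral_distr)
    also have "\<dots> = (LINT x|lborel. R ^ n * (indicator (cball 0 1) x * (x \<bullet> \<eta>) ^ (2 * m)))"
      using R by (intro Bochner_Integration.integral_cong)
        (auto simp: n_def power_add power_mult_distrib mult_ac split: split_indicator)
    also have "\<dots> = a * R ^ n" by (simp add: a_def)
    finally show ?thesis using int by (simp add: has_bochner_integral_iff)
  qed
  note G = gaussian_moment_inner[of \<eta> m]
  have "(LINT x|lborel. exp (- (norm x)\<^sup>2) * (x \<bullet> \<eta>) ^ (2 * m))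
      = (LINT r:{0<..}|lborel. exp (- r\<^sup>2) * (a * (real n * r ^ (n - 1))))"
  proof (rule radial_integral_nonneg(2))
    show "((\<lambda>r. a * r ^ n) has_real_derivative a * (real n * r ^ (n - 1))) (at r)" for r
      by (auto intro!: derivative_eq_intros)
    show "integrable lborel (\<lambda>x. exp (- (norm x)\<^sup>2) * (x \<bullet> \<eta>) ^ (2 * m))"
      using G by (simp add: has_bochner_integral_iff)
  qed (use ball in \<open>auto simp: zero_le_even_power\<close>)
  also have "\<dots> = a * real n * (LINT r:{0<..}|lborel. exp (- r\<^sup>2) * r ^ (n - 1))"
    by (subst set_integral_mult_right[symmetric]) (simp add: mult_ac)
  also have "\<dots> = a * Gamma (real n / 2 + 1)"
  proof -
    have "real n / 2 \<notin> \<int>\<^sub>\<le>\<^sub>0"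
      using n nonpos_Ints_nonpos[of "real n / 2"] by auto
    then have "Gamma (real n / 2 + 1) = real n / 2 * Gamma (real n / 2)"
      by (rule Gamma_plus1)
    then show ?thesis
      by (simp only: gaussian_moment_half_line[OF n])
  qed
  finally have "a * Gamma (real n / 2 + 1) = pi powr (DIM('a) / 2) * (fact (2 * m) / (4 ^ m * fact m)) * norm \<eta> ^ (2 * m)"
    using G by (simp add: has_bochner_integral_iff)
  moreover have "rGamma (real n / 2 + 1) * Gamma (real n / 2 + 1) = 1"
    using Gamma_real_pos[of "real n / 2 + 1"] n by (simp add: rGamma_inverse_Gamma less_imp_neq[symmetric])
  ultimately have "a = pi powr (DIM('a) / 2) * (fact (2 * m) / (4 ^ m * fact m)) * norm \<eta> ^ (2 * m) * rGamma (real n / 2 + 1)"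
    by (metis mult.assoc mult.commute mult.right_neutral)
  moreover have "real n / 2 + 1 = DIM('a) / 2 + m + 1" by (simp add: n_def)
  ultimately have a: "a = pi powr (DIM('a) / 2) * (fact (2 * m) / (4 ^ m * fact m)) * norm \<eta> ^ (2 * m) * rGamma (DIM('a) / 2 + m + 1)"
    by (simp only:)
  show ?thesis
    using ball[OF assms] unfolding a n_def by (simp only: mult_ac)
qed

text \<open>Used to read off the \<open>s^2\<close> term of an even power of
  \<open>norm (\<xi> + s v)\<close>, whose square is quadratic in \<open>s\<close>. The truncated
  \<open>n - 1\<close> at \<open>n = 0\<close> is harmless, its factor \<open>n\<close> being
  0.\<close>

lemma coeff_quadratic_power:
  fixes a b c :: "'a::field_char_0"
  shows "coeff ([:a, b, c:] ^ Suc n) 0 = a ^ Suc n"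
    and "coeff ([:a, b, c:] ^ Suc n) 1 = of_nat (Suc n) * b * a ^ n"
    and "coeff ([:a, b, c:] ^ Suc n) 2 = of_nat (Suc n) * (c * a ^ n + of_nat n * b\<^sup>2 / 2 * a ^ (n - 1))"
proof (induction n)
  case 0
  show "coeff ([:a, b, c:] ^ Suc 0) 0 = a ^ Suc 0" by simp
  show "coeff ([:a, b, c:] ^ Suc 0) 1 = of_nat (Suc 0) * b * a ^ 0" by simp
  show "coeff ([:a, b, c:] ^ Suc 0) 2 = of_nat (Suc 0) * (c * a ^ 0 + of_nat 0 * b\<^sup>2 / 2 * a ^ (0 - 1))"
    by (simp add: numeral_2_eq_2)
next
  case (Suc n)
  let ?p = "[:a, b, c:] ^ Suc n"
  have c0: "coeff ([:a, b, c:] * p) 0 = a * coeff p 0" for p by simp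
  have c1: "coeff ([:a, b, c:] * p) 1 = a * coeff p 1 + b * coeff p 0" for p by simp
  have c2: "coeff ([:a, b, c:] * p) 2 = a * coeff p 2 + b * coeff p 1 + c * coeff p 0" for p
    by (simp add: numeral_2_eq_2)
  note P = power_Suc[of "[:a, b, c:]" "Suc n"]
  show "coeff ([:a, b, c:] ^ Suc (Suc n)) 0 = a ^ Suc (Suc n)"
    unfolding P c0 Suc.IH by simp
  show "coeff ([:a, b, c:] ^ Suc (Suc n)) 1 = of_nat (Suc (Suc n)) * b * a ^ Suc n"
    unfolding P c1 Suc.IH by (simp add: algebra_simps)
  show "coeff ([:a, b, c:] ^ Suc (Suc n)) 2 = of_nat (Suc (Suc n)) * (c * a ^ Suc n + of_nat (Suc n) * b\<^sup>2 / 2 * a ^ (Suc n - 1))"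
    unfolding P c2 Suc.IH by (cases n) (simp_all add: field_simps power2_eq_square)
qed

text \<open>Polarisation: compare the coefficients of \<open>s\<^sup>2\<close> in the moments of \<open>\<xi> + s v\<close>.\<close>

lemma ball_moment_quadratic:
  fixes \<xi> v :: "'a::euclidean_space"
  assumes R: "R \<ge> 0"
  shows "has_bochner_integral lborel (\<lambda>x. indicator (cball 0 R) x * ((x \<bullet> v)\<^sup>2 * (x \<bullet> \<xi>) ^ (2 * m)))
     (pi powr (DIM('a) / 2) * (fact (2 * m) / (4 ^ m * fact m)) * rGamma (DIM('a) / 2 + m + 2)
        * ((norm v)\<^sup>2 * norm \<xi> ^ (2 * m) + 2 * real m * (v \<bullet> \<xi>)\<^sup>2 * norm \<xi> ^ (2 * (m - 1))) / 2
        * R ^ (DIM('a) + 2 * m + 2))"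
proof -
  \<comment> \<open>With this degree, the \<open>s^2\<close> term of the binomial expansion carries
    (x . v)^2 (x . \<xi>)^(2m).\<close>
  define N where "N = 2 * Suc m"
  have N2: "2 \<le> N" by (simp add: N_def)
  define A where "A k = (LINT x|lborel. indicator (cball 0 R) x * ((x \<bullet> v) ^ k * (x \<bullet> \<xi>) ^ (N - k)))" for k
  have int: "integrable lborel (\<lambda>x. indicator (cball 0 R) x * ((x \<bullet> v) ^ k * (x \<bullet> \<xi>) ^ l))" for k l
    by (auto intro!: integrable_indicator_cball continuous_intros)
  define C where "C = pi powr (DIM('a) / 2) * (fact N / (4 ^ Suc m * fact (Suc m))) * rGamma (DIM('a) / 2 + m + 2) * R ^ (DIM('a) + 2 * m + 2)"
  define p where "p = (\<Sum>k\<le>N. monom (of_nat (N choose k) * A k) k)"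
  \<comment> \<open>The quadratic is \<open>norm (\<xi> + s v)\<close> squared as a polynomial in
    \<open>s\<close>; \<open>q\<close> is the value that \<open>ball_moment\<close> gives for
    \<open>Suc m\<close>.\<close>
  define q where "q = smult C ([:(norm \<xi>)\<^sup>2, 2 * (v \<bullet> \<xi>), (norm v)\<^sup>2:] ^ Suc m)"
  have "poly p s = poly q s" for s
  proof -
    have "(LINT x|lborel. indicator (cball 0 R) x * (x \<bullet> (\<xi> + s *\<^sub>R v)) ^ N)
        = (LINT x|lborel. (\<Sum>k\<le>N. of_nat (N choose k) * s ^ k * (indicator (cball 0 R) x * ((x \<bullet> v) ^ k * (x \<bullet> \<xi>) ^ (N - k)))))"
    proof (intro Bochner_Integration.integral_cong refl)
      fix x :: 'a
      have "x \<bullet> (\<xi> + s *\<^sub>R v) = s * (x \<bullet> v) + x \<bullet> \<xi>" by (simp add: inner_simps)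
      then show "indicator (cball 0 R) x * (x \<bullet> (\<xi> + s *\<^sub>R v)) ^ N
        = (\<Sum>k\<le>N. of_nat (N choose k) * s ^ k * (indicator (cball 0 R) x * ((x \<bullet> v) ^ k * (x \<bullet> \<xi>) ^ (N - k))))"
        by (simp only: binomial_ring sum_distrib_left power_mult_distrib mult_ac)
    qed
    also have "\<dots> = (\<Sum>k\<le>N. of_nat (N choose k) * s ^ k * A k)"
      using int by (simp add: A_def)
    also have "\<dots> = poly p s"
      by (simp add: p_def poly_sum poly_monom mult_ac)
    finally have "poly p s = (LINT x|lborel. indicator (cball 0 R) x * (x \<bullet> (\<xi> + s *\<^sub>R v)) ^ N)" ..
    also have "\<dots> = C * norm (\<xi> + s *\<^sub>R v) ^ N"
      using ball_moment[OF R, of "\<xi> + s *\<^sub>R v" "Suc m"]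
      unfolding has_bochner_integral_iff N_def C_def by (simp add: mult_ac add_ac)
    also have "norm (\<xi> + s *\<^sub>R v) ^ N = (poly [:(norm \<xi>)\<^sup>2, 2 * (v \<bullet> \<xi>), (norm v)\<^sup>2:] s) ^ Suc m"
      unfolding N_def power_mult power2_norm_eq_inner
      by (simp add: inner_simps inner_commute algebra_simps del: power_Suc)
    finally show ?thesis by (simp only: q_def poly_smult poly_power)
  qed
  then have "p = q" by (simp add: poly_eq_poly_eq_iff[symmetric] fun_eq_iff)
  then have "coeff p 2 = coeff q 2" by simp
  moreover have "coeff p 2 = of_nat (N choose 2) * A 2"
    by (simp add: p_def coeff_sum N2)
  moreover have "coeff q 2 = C * (real (Suc m) * ((norm v)\<^sup>2 * norm \<xi> ^ (2 * m) + 2 * real m * (v \<bullet> \<xi>)\<^sup>2 * norm \<xi> ^ (2 * (m - 1))))"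
    unfolding q_def coeff_smult coeff_quadratic_power(3) power_mult
    by (simp add: power_mult_distrib)
  \<comment> \<open>The factor \<open>Suc m\<close> also occurs in the coefficient of
    \<open>q\<close> and cancels; \<open>2 m + 1\<close> is absorbed into the factorials of
    \<open>C\<close>.\<close>
  moreover have "real (N choose 2) = real (Suc m) * (2 * real m + 1)"
    by (simp add: N_def choose_two) (simp add: algebra_simps)
  ultimately have "real (Suc m) * ((2 * real m + 1) * A 2) = real (Suc m) * (C * ((norm v)\<^sup>2 * norm \<xi> ^ (2 * m) + 2 * real m * (v \<bullet> \<xi>)\<^sup>2 * norm \<xi> ^ (2 * (m - 1))))"
    by (simp only: mult_ac)
  then have "(2 * real m + 1) * A 2 = C * ((norm v)\<^sup>2 * norm \<xi> ^ (2 * m) + 2 * real m * (v \<bullet> \<xi>)\<^sup>2 * norm \<xi> ^ (2 * (m - 1)))"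
    by (subst (asm) mult_left_cancel) auto
  then have "A 2 = C / (2 * real m + 1) * ((norm v)\<^sup>2 * norm \<xi> ^ (2 * m) + 2 * real m * (v \<bullet> \<xi>)\<^sup>2 * norm \<xi> ^ (2 * (m - 1)))"
    by (simp add: nonzero_eq_divide_eq mult.commute)
  also have "C / (2 * real m + 1) = pi powr (DIM('a) / 2) * (fact (2 * m) / (4 ^ m * fact m)) * rGamma (DIM('a) / 2 + m + 2) / 2 * R ^ (DIM('a) + 2 * m + 2)"
  proof -
    have "(fact N / (4 ^ Suc m * fact (Suc m))) / (2 * real m + 1) = (fact (2 * m) / (4 ^ m * fact m)) / (2 :: real)"
      unfolding N_def by (simp add: divide_simps) (simp add: algebra_simps)
    then show ?thesis
      unfolding C_def by (simp add: divide_simps)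
  qed
  finally show ?thesis
    using int[of 2 "2 * m"] by (simp add: has_bochner_integral_iff A_def N_def mult_ac)
qed

section \<open>Cosine integrals and Bessel series\<close>

text \<open>Termwise differentiation concerns full power series, so the exponents
  \<open>N + 2 m\<close> are embedded into one with coefficient 0 everywhere else. By
  \<open>N > 0\<close> the exponent \<open>N + 2 m - 1\<close> is never truncated.\<close>

lemma has_real_derivative_even_step_series:
  fixes a :: "nat \<Rightarrow> real"
  assumes N: "N > 0" and sm: "\<And>r. summable (\<lambda>m. a m * r ^ (N + 2 * m))"
  shows "summable (\<lambda>m. real (N + 2 * m) * a m * r ^ (N + 2 * m - 1))"
    and "((\<lambda>r. \<Sum>m. a m * r ^ (N + 2 * m)) has_real_derivative
           (\<Sum>m. real (N + 2 * m) * a m * r ^ (N + 2 * m - 1))) (at r)"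
proof -
  define g where "g m = N + 2 * m" for m
  define c where "c n = (if n \<in> range g then a (inv g n) else 0)" for n
  have g: "strict_mono g" by (auto simp: strict_mono_def g_def)
  have ig: "inv g (g m) = m" for m
    by (rule inv_f_f) (auto simp: inj_def g_def)
  have cg: "c (g m) = a m" for m by (simp add: c_def ig)
  have c0: "c n = 0" if "n \<notin> range g" for n using that by (simp add: c_def)
  have sums: "(\<lambda>m. a m * r ^ g m) sums s \<longleftrightarrow> (\<lambda>n. c n * r ^ n) sums s" for r s
    using sums_mono_reindex[OF g, of "\<lambda>n. c n * r ^ n" s] c0 by (auto simp: cg)
  have smc: "summable (\<lambda>n. c n * r ^ n)" for r
    using sm[of r] sums[of r] by (auto simp: summable_def g_def)
  define g' where "g' m = g m - 1" for m
  have g': "strict_mono g'" using N by (auto simp: strict_mono_def g'_def g_def)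
  have d: "diffs c (g' m) * r ^ g' m = real (g m) * a m * r ^ (g m - 1)" for m r
  proof -
    have "Suc (g' m) = g m" using N by (simp add: g'_def g_def)
    then show ?thesis by (simp add: diffs_def cg g'_def)
  qed
  have d0: "diffs c n * r ^ n = 0" if "n \<notin> range g'" for n r
  proof -
    have "Suc n \<notin> range g"
    proof
      assume "Suc n \<in> range g"
      then obtain m where "Suc n = g m" by auto
      then have "n = g' m" by (simp add: g'_def)
      then show False using that by blast
    qed
    then show ?thesis by (simp add: diffs_def c0)
  qed
  have sums': "(\<lambda>m. real (g m) * a m * r ^ (g m - 1)) sums s \<longleftrightarrow> (\<lambda>n. diffs c n * r ^ n) sums s" for r s
    using sums_mono_reindex[OF g', of "\<lambda>n. diffs c n * r ^ n" s] d0 by (simp add: d)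
  have "summable (\<lambda>n. diffs c n * r ^ n)" for r
    using termdiff_converges_all[OF smc] .
  then have S: "(\<lambda>m. real (g m) * a m * r ^ (g m - 1)) sums (\<Sum>n. diffs c n * r ^ n)" for r
    by (subst sums') (rule summable_sums)
  then show "summable (\<lambda>m. real (N + 2 * m) * a m * r ^ (N + 2 * m - 1))"
    by (auto simp: g_def dest: sums_summable)
  have "((\<lambda>r. \<Sum>n. c n * r ^ n) has_real_derivative (\<Sum>n. diffs c n * r ^ n)) (at r)"
    by (rule termdiffs_strong_converges_everywhere[OF smc])
  also have "(\<lambda>r. \<Sum>n. c n * r ^ n) = (\<lambda>r. \<Sum>m. a m * r ^ g m)"
    using sums smc by (metis summable_sums sums_unique)
  also have "(\<Sum>n. diffs c n * r ^ n) = (\<Sum>m. real (g m) * a m * r ^ (g m - 1))"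
    using S by (simp add: sums_iff)
  finally show "((\<lambda>r. \<Sum>m. a m * r ^ (N + 2 * m)) has_real_derivative
           (\<Sum>m. real (N + 2 * m) * a m * r ^ (N + 2 * m - 1))) (at r)"
    by (simp add: g_def)
qed

text \<open>On the ball \<open>p\<close> is bounded by \<open>M\<close> and
  \<open>x \<bullet> \<eta>\<close> by \<open>z\<close>, so the terms are dominated by those of M
  cosh z; this justifies exchanging sum and integral.\<close>

lemma ball_integral_cos_series:
  fixes p :: "'a::euclidean_space \<Rightarrow> real"
  assumes p: "continuous_on UNIV p"
    and moment: "\<And>m. has_bochner_integral lborel (\<lambda>x. indicator (cball 0 R) x * (p x * (x \<bullet> \<eta>) ^ (2 * m))) (c m)"
  shows "summable (\<lambda>m. (-1) ^ m / fact (2 * m) * c m)"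
    and "has_bochner_integral lborel (\<lambda>x. indicator (cball 0 R) x * (p x * cos (x \<bullet> \<eta>)))
           (\<Sum>m. (-1) ^ m / fact (2 * m) * c m)"
proof -
  define f where "f m x = (-1) ^ m / fact (2 * m) * (indicator (cball 0 R) x * (p x * (x \<bullet> \<eta>) ^ (2 * m)))" for m x
  have int: "integrable lborel (f m)" for m
    unfolding f_def using moment[of m] by (auto simp: has_bochner_integral_iff)
  have fint: "integral\<^sup>L lborel (f m) = (-1) ^ m / fact (2 * m) * c m" for m
    unfolding f_def using moment[of m] by (auto simp: has_bochner_integral_iff)
  have "compact (p ` cball 0 R)"
    using p by (intro compact_continuous_image) (auto intro: continuous_on_subset)
  then have "bounded (p ` cball 0 R)" by (rule compact_imp_bounded)
  then obtain M where "\<forall>y\<in>p ` cball 0 R. norm y \<le> M"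
    unfolding bounded_iff by blast
  then have M: "\<bar>p x\<bar> \<le> M" if "x \<in> cball 0 R" for x
    using that by auto
  define z where "z = R * norm \<eta>"
  have bound: "norm (f m x) \<le> M * (z ^ (2 * m) / fact (2 * m)) * indicator (cball 0 R) x" for m x
  proof (cases "x \<in> cball 0 R")
    case True
    have "\<bar>x \<bullet> \<eta>\<bar> \<le> z"
      using Cauchy_Schwarz_ineq2[of x \<eta>] mult_right_mono[of "norm x" R "norm \<eta>"] True by (simp add: z_def)
    then have "\<bar>x \<bullet> \<eta>\<bar> ^ (2 * m) \<le> z ^ (2 * m)" by (intro power_mono) auto
    then have "\<bar>p x\<bar> * \<bar>x \<bullet> \<eta>\<bar> ^ (2 * m) \<le> M * z ^ (2 * m)"
      using M[OF True] by (intro mult_mono) auto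
    then have "\<bar>p x\<bar> * \<bar>x \<bullet> \<eta>\<bar> ^ (2 * m) / fact (2 * m) \<le> M * z ^ (2 * m) / fact (2 * m)"
      by (intro divide_right_mono) auto
    then show ?thesis
      using True by (simp add: f_def abs_mult power_abs)
  qed (simp add: f_def)
  have summ: "summable (\<lambda>m. M * (z ^ (2 * m) / fact (2 * m)))"
    using sums_mult[OF cosh_paired[of z], of M] by (rule sums_summable)
  have ind: "integrable lborel (indicator (cball (0::'a) R) :: 'a \<Rightarrow> real)"
    by (rule integrable_real_indicator[OF _ emeasure_lborel_cball_finite]) simp
  have s1: "summable (\<lambda>m. norm (f m x))" for x
    by (rule summable_comparison_test'[OF summable_mult2[OF summ, of "indicator (cball 0 R) x"], of 0])
       (use bound[of _ x] in auto)
  have s2: "summable (\<lambda>m. LINT x|lborel. norm (f m x))"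
  proof (rule summable_comparison_test'[OF summable_mult2[OF summ, of "integral\<^sup>L lborel (indicator (cball (0::'a) R))"], of 0])
    fix m
    have "(LINT x|lborel. norm (f m x)) \<le> (LINT x|(lborel :: 'a measure). M * (z ^ (2 * m) / fact (2 * m)) * indicator (cball 0 R) x)"
      using int[of m] ind bound[of m] by (intro integral_mono) auto
    then show "norm (LINT x|lborel. norm (f m x)) \<le> M * (z ^ (2 * m) / fact (2 * m)) * integral\<^sup>L lborel (indicator (cball (0::'a) R))"
      by simp
  qed
  have sum: "(\<Sum>m. f m x) = indicator (cball 0 R) x * (p x * cos (x \<bullet> \<eta>))" for x
  proof -
    have "(\<lambda>m. indicator (cball 0 R) x * p x * ((-1) ^ m / fact (2 * m) * (x \<bullet> \<eta>) ^ (2 * m))) sums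
        (indicator (cball 0 R) x * p x * cos (x \<bullet> \<eta>))"
      by (intro sums_mult cos_paired)
    then show ?thesis by (simp add: sums_iff f_def mult_ac)
  qed
  show "summable (\<lambda>m. (-1) ^ m / fact (2 * m) * c m)"
    using summable_integral[of lborel f] int s1 s2 by (simp add: fint)
  have "integrable lborel (\<lambda>x. \<Sum>m. f m x)"
    using int s1 s2 by (intro integrable_suminf) auto
  moreover have "(LINT x|lborel. (\<Sum>m. f m x)) = (\<Sum>m. integral\<^sup>L lborel (f m))"
    using int s1 s2 by (intro integral_suminf) auto
  ultimately show "has_bochner_integral lborel (\<lambda>x. indicator (cball 0 R) x * (p x * cos (x \<bullet> \<eta>)))
           (\<Sum>m. (-1) ^ m / fact (2 * m) * c m)"
    by (simp add: has_bochner_integral_iff sum fint)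
qed

text \<open>For homogeneous \<open>p\<close>, the exponent \<open>N\<close> is the dimension plus
  the degree of \<open>p\<close>. The dominating weight is \<open>p\<close> itself, whence the
  hypothesis \<open>int\<close>.\<close>

lemma radial_integral_cos:
  fixes p :: "'a::euclidean_space \<Rightarrow> real" and c :: "'a \<Rightarrow> nat \<Rightarrow> real"
  assumes p: "continuous_on UNIV p" "\<And>x. p x \<ge> 0" and N: "N > 0"
    and moment: "\<And>\<eta> R m. R \<ge> 0 \<Longrightarrow> has_bochner_integral lborel
        (\<lambda>x. indicator (cball 0 R) x * (p x * (x \<bullet> \<eta>) ^ (2 * m))) (c \<eta> m * R ^ (N + 2 * m))"
    and f: "(\<lambda>x::'a. f (norm x)) \<in> borel_measurable lebesgue"
    and int: "integrable lebesgue (\<lambda>x. f (norm x) * p x)"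
  defines "D \<equiv> \<lambda>\<eta> r. \<Sum>m. real (N + 2 * m) * ((-1) ^ m / fact (2 * m) * c \<eta> m) * r ^ (N + 2 * m - 1)"
  shows "set_integrable lebesgue {0<..} (\<lambda>r. f r * D \<eta> r)"
    and "(LINT x|lebesgue. f (norm x) * (p x * cos (x \<bullet> \<eta>))) = (LINT r:{0<..}|lebesgue. f r * D \<eta> r)"
proof -
  define a where "a \<eta> m = (-1) ^ m / fact (2 * m) * c \<eta> m" for \<eta> m
  define W where "W \<eta> r = (\<Sum>m. a \<eta> m * r ^ (N + 2 * m))" for \<eta> r
  have D: "D \<eta> r = (\<Sum>m. real (N + 2 * m) * a \<eta> m * r ^ (N + 2 * m - 1))" for \<eta> r
    by (simp add: D_def a_def)
  have series: "summable (\<lambda>m. a \<eta> m * R ^ (N + 2 * m))"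
      "has_bochner_integral lborel (\<lambda>x. indicator (cball 0 R) x * (p x * cos (x \<bullet> \<eta>))) (W \<eta> R)"
    if "R \<ge> 0" for \<eta> R
    using ball_integral_cos_series[OF p(1) moment[OF that, of \<eta>]] by (simp_all add: a_def W_def mult.assoc)
  \<comment> \<open>The derivative is required at every real \<open>r\<close>, while moments give
    summability for \<open>r >= 0\<close> only; the common parity of the exponents extends
    it.\<close>
  have sm: "summable (\<lambda>m. a \<eta> m * r ^ (N + 2 * m))" for \<eta> r
  proof (cases "r \<ge> 0")
    case True
    then show ?thesis by (rule series)
  next
    case False
    have eq: "a \<eta> m * r ^ (N + 2 * m) = (-1) ^ N * (a \<eta> m * (- r) ^ (N + 2 * m))" for m
      by (simp add: power_add power_mult power_minus[of r N])
    show ?thesis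
      unfolding eq using False by (intro summable_mult series) simp
  qed
  have deriv: "(W \<eta> has_real_derivative D \<eta> r) (at r)" for \<eta> r
    using has_real_derivative_even_step_series(2)[OF N sm[of \<eta>]] by (simp add: D W_def[abs_def])
  have [measurable]: "D \<eta> \<in> borel_measurable borel" for \<eta>
    unfolding D_def by measurable
  have [measurable]: "p \<in> borel_measurable borel"
    using p(1) by (rule borel_measurable_continuous_onI)
  have bound: "\<bar>p x * cos (x \<bullet> \<eta>)\<bar> \<le> p x" for x
    using p(2)[of x] by (simp add: abs_mult mult_left_le)
  \<comment> \<open>\<open>p\<close> is the case of frequency 0, so the same series also supplies
    its density.\<close>
  have p0: "has_bochner_integral lborel (\<lambda>x. indicator (cball 0 R) x * p x) (W 0 R)" if "R \<ge> 0" for R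
    using series(2)[OF that, of 0] by simp
  note rad = radial_integral[OF _ _ _ _ bound series(2) p0 deriv deriv f int, simplified]
  show "set_integrable lebesgue {0<..} (\<lambda>r. f r * D \<eta> r)"
    and "(LINT x|lebesgue. f (norm x) * (p x * cos (x \<bullet> \<eta>))) = (LINT r:{0<..}|lebesgue. f r * D \<eta> r)"
    using rad by simp_all
qed

section \<open>Bessel kernels as power series\<close>

definition bessel_kernel_0 :: "real \<Rightarrow> real \<Rightarrow> real \<Rightarrow> real" where
  "bessel_kernel_0 \<mu> \<rho> r = 2 * pi / \<rho> powr \<mu> * (r powr (\<mu> + 1) * bessel_J \<mu> (2 * pi * \<rho> * r))"

text \<open>With \<mu> = d/2 - 1 and |\<xi>| = \<rho>, both kernels are integrals over the sphere of
  radius \<open>r\<close>, prefactors included: \<open>bessel_kernel_0\<close> that of cos(2 pi x .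
  \<xi>), \<open>bessel_kernel_1\<close> that of (x . v)^2 / r^2 times this cosine, for a unit
  vector \<open>v\<close> orthogonal to \<xi>.\<close>

definition bessel_kernel_1 :: "real \<Rightarrow> real \<Rightarrow> real \<Rightarrow> real" where
  "bessel_kernel_1 \<mu> \<rho> r = 1 / \<rho> powr (\<mu> + 1) * (r powr \<mu> * bessel_J (\<mu> + 1) (2 * pi * \<rho> * r))"

lemma rGamma_real_plus1: "z * rGamma (z + 1) = rGamma (z :: real)"
  using rGamma_plus1[of z] by simp

text \<open>With \<open>A\<close> collecting the common factors, consecutive terms have sizes
  \<open>A x^2 / (n + 1)\<close> and \<open>A (n + \<nu> + 1)\<close>; beyond \<open>?N\<close> the
  former is at most half the latter. No quotient is formed, as \<open>rGamma\<close> may vanish for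
  negative \<nu>.\<close>

lemma summable_bessel_series:
  fixes x \<nu> :: real
  shows "summable (\<lambda>m. (-1) ^ m / fact m * rGamma (real m + \<nu> + 1) * x ^ (2 * m))"
proof (rule summable_ratio_test)
  let ?N = "nat \<lceil>2 * x\<^sup>2 + \<bar>\<nu>\<bar>\<rceil>"
  fix n assume "n \<ge> ?N"
  then have "real n \<ge> 2 * x\<^sup>2 + \<bar>\<nu>\<bar>" by linarith
  then have n: "x\<^sup>2 \<le> (real n + \<nu> + 1) / 2" using abs_ge_minus_self[of \<nu>] by (simp add: field_simps)
  define A where "A = \<bar>rGamma (real n + \<nu> + 2)\<bar> * x ^ (2 * n) / fact n"
  have A: "A \<ge> 0" by (simp add: A_def zero_le_even_power)
  have x: "x ^ (2 * Suc n) = x\<^sup>2 * x ^ (2 * n)" "\<bar>x ^ (2 * n)\<bar> = x ^ (2 * n)"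
    by (simp_all add: power2_eq_square zero_le_even_power)
  have "norm ((-1) ^ Suc n / fact (Suc n) * rGamma (real (Suc n) + \<nu> + 1) * x ^ (2 * Suc n)) = A * (x\<^sup>2 / (real n + 1))"
    unfolding x(1) by (simp add: A_def abs_mult x(2) add_ac) (simp add: mult_ac)
  also have "\<dots> \<le> A * ((real n + \<nu> + 1) / 2)"
  proof (rule mult_left_mono[OF _ A])
    have "x\<^sup>2 / (real n + 1) \<le> x\<^sup>2 / 1" by (intro divide_left_mono) auto
    with n show "x\<^sup>2 / (real n + 1) \<le> (real n + \<nu> + 1) / 2" by linarith
  qed
  also have "\<dots> = 1 / 2 * norm ((-1) ^ n / fact n * rGamma (real n + \<nu> + 1) * x ^ (2 * n))"
  proof -
    have "rGamma (real n + \<nu> + 1) = (real n + \<nu> + 1) * rGamma (real n + \<nu> + 2)"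
      using rGamma_real_plus1[of "real n + \<nu> + 1"] by (simp add: add_ac)
    moreover have "real n + \<nu> + 1 \<ge> 0" using order_trans[OF zero_le_power2 n] by simp
    ultimately show ?thesis
      by (simp add: A_def abs_mult x(2)) (simp add: mult_ac)
  qed
  finally show "norm ((-1) ^ Suc n / fact (Suc n) * rGamma (real (Suc n) + \<nu> + 1) * x ^ (2 * Suc n))
    \<le> 1 / 2 * norm ((-1) ^ n / fact n * rGamma (real n + \<nu> + 1) * x ^ (2 * n))" .
qed simp

context
  fixes \<mu> \<rho> r :: real and d :: nat
  assumes d: "real d = 2 * \<mu> + 2" "d > 0" and \<rho>: "\<rho> > 0" and r: "r > 0"
begin

lemma powr_bessel_argument:
  "(2 * pi * \<rho> * r / 2) powr (2 * real m + \<nu>) = (pi * \<rho>) ^ (2 * m) * r ^ (2 * m) * pi powr \<nu> * \<rho> powr \<nu> * r powr \<nu>"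
proof -
  have "(2 * pi * \<rho> * r / 2) powr (2 * real m + \<nu>) = (pi * \<rho> * r) powr real (2 * m) * (pi * \<rho> * r) powr \<nu>"
    by (simp add: powr_add mult.assoc)
  also have "(pi * \<rho> * r) powr real (2 * m) = (pi * \<rho> * r) ^ (2 * m)"
    using \<rho> r by (intro powr_realpow) simp
  also have "(pi * \<rho> * r) powr \<nu> = pi powr \<nu> * \<rho> powr \<nu> * r powr \<nu>"
    using \<rho> r by (simp add: powr_mult)
  finally show ?thesis by (simp add: power_mult_distrib mult_ac)
qed

text \<open>The splitting d - 1 = (\<mu> + 1) + \<mu> matches the natural powers of the densities
  with the real powers of the Bessel series. In \<open>bessel_kernel_0\<close> the factor
  \<open>r powr (\<mu> + 1)\<close> is explicit and \<open>r powr \<mu>\<close> comes from the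
  series; in \<open>bessel_kernel_1\<close> the roles are exchanged.\<close>

lemma radial_power: "r ^ (d + 2 * m - 1) = r powr (\<mu> + 1) * r powr \<mu> * r ^ (2 * m)"
proof -
  have "r ^ (d + 2 * m - 1) = r powr real (d + 2 * m - 1)"
    using r by (simp add: powr_realpow)
  also have "real (d + 2 * m - 1) = (\<mu> + 1) + \<mu> + real (2 * m)"
    using d by (cases d) auto
  also have "r powr \<dots> = r powr (\<mu> + 1) * r powr \<mu> * r ^ (2 * m)"
    using r by (simp only: powr_add powr_realpow)
  finally show ?thesis .
qed

lemma bessel_J_series:
  "(\<lambda>m. (-1) ^ m / fact m * rGamma (real m + \<nu> + 1) * (2 * pi * \<rho> * r / 2) powr (2 * real m + \<nu>)) sums bessel_J \<nu> (2 * pi * \<rho> * r)"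
proof -
  have "(-1) ^ m / fact m * rGamma (real m + \<nu> + 1) * (2 * pi * \<rho> * r / 2) powr (2 * real m + \<nu>)
      = (-1) ^ m / fact m * rGamma (real m + \<nu> + 1) * (pi * \<rho> * r) ^ (2 * m) * (pi powr \<nu> * \<rho> powr \<nu> * r powr \<nu>)" for m
    unfolding powr_bessel_argument by (simp add: power_mult_distrib mult_ac)
  then have "summable (\<lambda>m. (-1) ^ m / fact m * rGamma (real m + \<nu> + 1) * (2 * pi * \<rho> * r / 2) powr (2 * real m + \<nu>))"
    by (simp only: summable_mult2[OF summable_bessel_series[of \<nu> "pi * \<rho> * r"]])
  then show ?thesis
    unfolding bessel_J_def by (rule summable_sums)
qed

lemma sums_bessel_kernel_0:
  "(\<lambda>m. 2 * pi powr (\<mu> + 1) * ((-1) ^ m / fact m * rGamma (real m + \<mu> + 1) * (pi * \<rho>) ^ (2 * m)) * r ^ (d + 2 * m - 1))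
     sums bessel_kernel_0 \<mu> \<rho> r"
proof -
  have "2 * pi powr (\<mu> + 1) * ((-1) ^ m / fact m * rGamma (real m + \<mu> + 1) * (pi * \<rho>) ^ (2 * m)) * r ^ (d + 2 * m - 1)
      = 2 * pi / \<rho> powr \<mu> * r powr (\<mu> + 1)
        * ((-1) ^ m / fact m * rGamma (real m + \<mu> + 1) * (2 * pi * \<rho> * r / 2) powr (2 * real m + \<mu>))" for m
  proof -
    have "pi powr (\<mu> + 1) = pi * pi powr \<mu>" by (simp add: powr_add)
    then show ?thesis
      unfolding powr_bessel_argument radial_power using \<rho> by simp
  qed
  then show ?thesis
    using sums_mult[OF bessel_J_series[of \<mu>], of "2 * pi / \<rho> powr \<mu> * r powr (\<mu> + 1)"]
    by (simp only: bessel_kernel_0_def mult.assoc)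
qed

lemma sums_bessel_kernel_1:
  "(\<lambda>m. pi powr (\<mu> + 1) * ((-1) ^ m / fact m * rGamma (real m + (\<mu> + 1) + 1) * (pi * \<rho>) ^ (2 * m)) * r ^ (d + 2 * m - 1))
     sums bessel_kernel_1 \<mu> \<rho> r"
proof -
  have "pi powr (\<mu> + 1) * ((-1) ^ m / fact m * rGamma (real m + (\<mu> + 1) + 1) * (pi * \<rho>) ^ (2 * m)) * r ^ (d + 2 * m - 1)
      = 1 / \<rho> powr (\<mu> + 1) * r powr \<mu>
        * ((-1) ^ m / fact m * rGamma (real m + (\<mu> + 1) + 1) * (2 * pi * \<rho> * r / 2) powr (2 * real m + (\<mu> + 1)))" for m
    unfolding powr_bessel_argument radial_power using \<rho> by simp
  then show ?thesis
    using sums_mult[OF bessel_J_series[of "\<mu> + 1"], of "1 / \<rho> powr (\<mu> + 1) * r powr \<mu>"]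
    by (simp only: bessel_kernel_1_def mult.assoc)
qed

end

section \<open>Radial cosine transforms\<close>

lemma radial_fourier_cos:
  fixes \<xi> :: "'a::euclidean_space" and f :: "real \<Rightarrow> real" and \<mu> :: real
  assumes \<mu>: "\<mu> = DIM('a) / 2 - 1" and \<xi>: "\<xi> \<noteq> 0"
    and int: "integrable lebesgue (\<lambda>x::'a. f (norm x))"
  shows "set_integrable lebesgue {0<..} (\<lambda>r. f r * bessel_kernel_0 \<mu> (norm \<xi>) r)"
    and "(LINT x|lebesgue. f (norm x) * cos (x \<bullet> ((2 * pi) *\<^sub>R \<xi>)))
           = (LINT r:{0<..}|lebesgue. f r * bessel_kernel_0 \<mu> (norm \<xi>) r)"
proof -
  define d where "d = DIM('a)"
  have d: "real d = 2 * \<mu> + 2" "d > 0" using \<mu> by (simp_all add: d_def)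
  define c where "c \<eta> m = pi powr (DIM('a) / 2) * (fact (2 * m) / (4 ^ m * fact m)) * rGamma (DIM('a) / 2 + m + 1)
        * norm \<eta> ^ (2 * m)" for \<eta> :: 'a and m
  define \<eta> where "\<eta> = (2 * pi) *\<^sub>R \<xi>"
  define D where "D r = (\<Sum>m. real (d + 2 * m) * ((-1) ^ m / fact (2 * m) * c \<eta> m) * r ^ (d + 2 * m - 1))" for r
  have mom: "has_bochner_integral lborel (\<lambda>x. indicator (cball 0 R) x * (1 * (x \<bullet> \<eta>) ^ (2 * m))) (c \<eta> m * R ^ (d + 2 * m))"
    if "R \<ge> 0" for \<eta> :: 'a and R m
    using ball_moment[OF that, of \<eta> m] by (simp add: c_def d_def)
  have meas: "(\<lambda>x::'a. f (norm x)) \<in> borel_measurable lebesgue"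
    using int by (rule borel_measurable_integrable)
  have int1: "integrable lebesgue (\<lambda>x::'a. f (norm x) * 1)" using int by simp
  note R = radial_integral_cos[where p = "\<lambda>_. 1" and c = c and N = d and f = f,
      OF continuous_on_const zero_le_one d(2) mom meas int1, of \<eta>, folded D_def, simplified mult_1]
  have D: "D r = bessel_kernel_0 \<mu> (norm \<xi>) r" if "r > 0" for r
  proof -
    have t: "real (d + 2 * m) * ((-1) ^ m / fact (2 * m) * c \<eta> m) * r ^ (d + 2 * m - 1)
        = 2 * pi powr (\<mu> + 1) * ((-1) ^ m / fact m * rGamma (real m + \<mu> + 1) * (pi * norm \<xi>) ^ (2 * m)) * r ^ (d + 2 * m - 1)" for m
    proof -
      \<comment> \<open>The \<open>4 ^ m\<close> from the frequency 2 pi \<xi> cancels the one in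
        the moments.\<close>
      have n: "norm \<eta> ^ (2 * m) = 4 ^ m * (pi * norm \<xi>) ^ (2 * m)"
        by (simp add: \<eta>_def power_mult_distrib power_mult)
      \<comment> \<open>Differentiation brings down \<open>d + 2 m\<close>, and the functional
        equation absorbs it by lowering the argument of \<open>rGamma\<close> to the one in the
        series of order \<mu>.\<close>
      have g: "real (d + 2 * m) * rGamma (DIM('a) / 2 + m + 1) = 2 * rGamma (real m + \<mu> + 1)"
      proof -
        have "real (d + 2 * m) = 2 * (real m + \<mu> + 1)" "DIM('a) / 2 + m + 1 = real m + \<mu> + 1 + 1"
          using d by (simp_all add: d_def)
        then show ?thesis by (simp only: mult.assoc rGamma_real_plus1)
      qed
      have e: "pi powr (DIM('a) / 2) = pi powr (\<mu> + 1)" using \<mu> by simp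
      have "real (d + 2 * m) * ((-1) ^ m / fact (2 * m) * c \<eta> m) * r ^ (d + 2 * m - 1)
          = (real (d + 2 * m) * rGamma (DIM('a) / 2 + m + 1)) * ((-1) ^ m / fact (2 * m) * (pi powr (\<mu> + 1) * (fact (2 * m) / (4 ^ m * fact m))
              * (4 ^ m * (pi * norm \<xi>) ^ (2 * m)))) * r ^ (d + 2 * m - 1)"
        unfolding c_def n e by (simp only: mult_ac times_divide_eq_left times_divide_eq_right divide_divide_eq_left)
      also have "\<dots> = 2 * pi powr (\<mu> + 1) * ((-1) ^ m / fact m * rGamma (real m + \<mu> + 1) * (pi * norm \<xi>) ^ (2 * m)) * r ^ (d + 2 * m - 1)"
        unfolding g by simp
      finally show ?thesis .
    qed
    show ?thesis
      using sums_bessel_kernel_0[OF d _ that, of "norm \<xi>"] \<xi>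
      unfolding t D_def by (simp add: sums_iff)
  qed
  show "set_integrable lebesgue {0<..} (\<lambda>r. f r * bessel_kernel_0 \<mu> (norm \<xi>) r)"
    using R(1) by (rule set_integrable_cong[THEN iffD1, rotated -1]) (auto simp: D)
  have "(LINT r:{0<..}|lebesgue. f r * D r) = (LINT r:{0<..}|lebesgue. f r * bessel_kernel_0 \<mu> (norm \<xi>) r)"
    by (rule set_lebesgue_integral_cong) (auto simp: D)
  then show "(LINT x|lebesgue. f (norm x) * cos (x \<bullet> ((2 * pi) *\<^sub>R \<xi>)))
           = (LINT r:{0<..}|lebesgue. f r * bessel_kernel_0 \<mu> (norm \<xi>) r)"
    using R(2) by (simp add: \<eta>_def)
qed

text \<open>\<beta> is the squared length of the component of \<open>v\<close> along \<xi>. The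
  moments yield |v|^2 + 2 m \<beta> times the m-th term of \<open>bessel_kernel_1\<close>; since the
  m-th term of \<open>bessel_kernel_0\<close> is 2 (m + \<mu> + 1) times that term, the dependence
  on \<open>m\<close> is traded for \<beta> times \<open>bessel_kernel_0\<close>, which leaves -(2
  \<mu> + 2) \<beta>. Integrability is asked only after multiplication by (x . v)^2, because
  \<open>f\<close> will contain the factor 1 / r^2.\<close>

lemma radial_fourier_cos_quadratic:
  fixes \<xi> v :: "'a::euclidean_space" and f :: "real \<Rightarrow> real" and \<mu> :: real
  assumes \<mu>: "\<mu> = DIM('a) / 2 - 1" and \<xi>: "\<xi> \<noteq> 0"
    and meas: "(\<lambda>x::'a. f (norm x)) \<in> borel_measurable lebesgue"
    and int: "integrable lebesgue (\<lambda>x::'a. f (norm x) * (x \<bullet> v)\<^sup>2)"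
  defines "\<beta> \<equiv> (v \<bullet> \<xi>)\<^sup>2 / (norm \<xi>)\<^sup>2"
  defines "\<Phi> \<equiv> \<lambda>r. ((norm v)\<^sup>2 - (2 * \<mu> + 2) * \<beta>) * bessel_kernel_1 \<mu> (norm \<xi>) r + \<beta> * bessel_kernel_0 \<mu> (norm \<xi>) r"
  shows "set_integrable lebesgue {0<..} (\<lambda>r. f r * (r\<^sup>2 * \<Phi> r))"
    and "(LINT x|lebesgue. f (norm x) * ((x \<bullet> v)\<^sup>2 * cos (x \<bullet> ((2 * pi) *\<^sub>R \<xi>))))
           = (LINT r:{0<..}|lebesgue. f r * (r\<^sup>2 * \<Phi> r))"
proof -
  define d where "d = DIM('a)"
  have d: "real d = 2 * \<mu> + 2" "d > 0" using \<mu> by (simp_all add: d_def)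
  have d2: "d + 2 > 0" by simp
  define c where "c \<eta> m = pi powr (DIM('a) / 2) * (fact (2 * m) / (4 ^ m * fact m)) * rGamma (DIM('a) / 2 + m + 2)
        * ((norm v)\<^sup>2 * norm \<eta> ^ (2 * m) + 2 * real m * (v \<bullet> \<eta>)\<^sup>2 * norm \<eta> ^ (2 * (m - 1))) / 2" for \<eta> :: 'a and m
  define \<eta> where "\<eta> = (2 * pi) *\<^sub>R \<xi>"
  define D where "D r = (\<Sum>m. real (d + 2 + 2 * m) * ((-1) ^ m / fact (2 * m) * c \<eta> m) * r ^ (d + 2 + 2 * m - 1))" for r
  have mom: "has_bochner_integral lborel (\<lambda>x. indicator (cball 0 R) x * ((x \<bullet> v)\<^sup>2 * (x \<bullet> \<eta>) ^ (2 * m))) (c \<eta> m * R ^ (d + 2 + 2 * m))"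
    if "R \<ge> 0" for \<eta> :: 'a and R m
    using ball_moment_quadratic[OF that, of v \<eta> m] by (simp add: c_def d_def add_ac)
  have cont: "continuous_on UNIV (\<lambda>x::'a. (x \<bullet> v)\<^sup>2)" by (intro continuous_intros)
  note R = radial_integral_cos[where p = "\<lambda>x. (x \<bullet> v)\<^sup>2" and c = c and N = "d + 2" and f = f,
      OF cont zero_le_power2 d2 mom meas int, of \<eta>, folded D_def]
  have D: "D r = r\<^sup>2 * \<Phi> r" if r: "r > 0" for r
  proof -
    define t0 where "t0 m = 2 * pi powr (\<mu> + 1) * ((-1) ^ m / fact m * rGamma (real m + \<mu> + 1) * (pi * norm \<xi>) ^ (2 * m)) * r ^ (d + 2 * m - 1)" for m
    define t1 where "t1 m = pi powr (\<mu> + 1) * ((-1) ^ m / fact m * rGamma (real m + (\<mu> + 1) + 1) * (pi * norm \<xi>) ^ (2 * m)) * r ^ (d + 2 * m - 1)" for m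
    have t01: "t0 m = 2 * (real m + \<mu> + 1) * t1 m" for m
      unfolding t0_def t1_def rGamma_real_plus1[of "real m + \<mu> + 1", symmetric] by (simp add: add_ac)
    have t: "real (d + 2 + 2 * m) * ((-1) ^ m / fact (2 * m) * c \<eta> m) * r ^ (d + 2 + 2 * m - 1)
        = r\<^sup>2 * (((norm v)\<^sup>2 - (2 * \<mu> + 2) * \<beta>) * t1 m + \<beta> * t0 m)" for m
    proof -
      have n: "norm \<eta> ^ (2 * m) = 4 ^ m * (pi * norm \<xi>) ^ (2 * m)"
        by (simp add: \<eta>_def power_mult_distrib power_mult)
      \<comment> \<open>At \<open>m = 0\<close> both sides vanish, whatever the truncated
        \<open>m - 1\<close> is.\<close>
      have "real m * (v \<bullet> \<eta>)\<^sup>2 * norm \<eta> ^ (2 * (m - 1)) = real m * \<beta> * norm \<eta> ^ (2 * m)"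
        using \<xi> by (cases m) (simp_all add: \<beta>_def \<eta>_def power_mult_distrib power2_eq_square field_simps)
      then have q: "(norm v)\<^sup>2 * norm \<eta> ^ (2 * m) + 2 * real m * (v \<bullet> \<eta>)\<^sup>2 * norm \<eta> ^ (2 * (m - 1))
          = ((norm v)\<^sup>2 + 2 * real m * \<beta>) * (4 ^ m * (pi * norm \<xi>) ^ (2 * m))"
        unfolding n by (simp add: algebra_simps)
      have g: "real (d + 2 + 2 * m) * rGamma (DIM('a) / 2 + m + 2) = 2 * rGamma (real m + (\<mu> + 1) + 1)"
      proof -
        have "real (d + 2 + 2 * m) = 2 * (real m + (\<mu> + 1) + 1)" "DIM('a) / 2 + m + 2 = real m + (\<mu> + 1) + 1 + 1"
          using d by (simp_all add: d_def)
        then show ?thesis by (simp only: mult.assoc rGamma_real_plus1)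
      qed
      have e: "pi powr (DIM('a) / 2) = pi powr (\<mu> + 1)" using \<mu> by simp
      have p: "r ^ (d + 2 + 2 * m - 1) = r\<^sup>2 * r ^ (d + 2 * m - 1)"
        using d by (cases d) (auto simp: power2_eq_square)
      have "real (d + 2 + 2 * m) * ((-1) ^ m / fact (2 * m) * c \<eta> m) * r ^ (d + 2 + 2 * m - 1)
          = (real (d + 2 + 2 * m) * rGamma (DIM('a) / 2 + m + 2)) * ((-1) ^ m / fact (2 * m) * (pi powr (\<mu> + 1) * (fact (2 * m) / (4 ^ m * fact m))
              * (((norm v)\<^sup>2 + 2 * real m * \<beta>) * (4 ^ m * (pi * norm \<xi>) ^ (2 * m))) / 2)) * (r\<^sup>2 * r ^ (d + 2 * m - 1))"
        unfolding c_def q p e by (simp only: mult_ac times_divide_eq_left times_divide_eq_right divide_divide_eq_left)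
      also have "\<dots> = r\<^sup>2 * (((norm v)\<^sup>2 + 2 * real m * \<beta>) * t1 m)"
        unfolding g t1_def by simp
      also have "((norm v)\<^sup>2 + 2 * real m * \<beta>) * t1 m = ((norm v)\<^sup>2 - (2 * \<mu> + 2) * \<beta>) * t1 m + \<beta> * t0 m"
        unfolding t01 by (simp add: algebra_simps)
      finally show ?thesis .
    qed
    have "t0 sums bessel_kernel_0 \<mu> (norm \<xi>) r" "t1 sums bessel_kernel_1 \<mu> (norm \<xi>) r"
      using sums_bessel_kernel_0[OF d _ r, of "norm \<xi>"] sums_bessel_kernel_1[OF d _ r, of "norm \<xi>"] \<xi>
      by (simp_all add: t0_def[abs_def] t1_def[abs_def])
    then have "(\<lambda>m. r\<^sup>2 * (((norm v)\<^sup>2 - (2 * \<mu> + 2) * \<beta>) * t1 m + \<beta> * t0 m)) sums (r\<^sup>2 * \<Phi> r)"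
      unfolding \<Phi>_def by (intro sums_mult sums_add)
    then show ?thesis
      unfolding t D_def by (simp add: sums_iff)
  qed
  show "set_integrable lebesgue {0<..} (\<lambda>r. f r * (r\<^sup>2 * \<Phi> r))"
    using R(1) by (rule set_integrable_cong[THEN iffD1, rotated -1]) (auto simp: D)
  have "(LINT r:{0<..}|lebesgue. f r * D r) = (LINT r:{0<..}|lebesgue. f r * (r\<^sup>2 * \<Phi> r))"
    by (rule set_lebesgue_integral_cong) (auto simp: D)
  then show "(LINT x|lebesgue. f (norm x) * ((x \<bullet> v)\<^sup>2 * cos (x \<bullet> ((2 * pi) *\<^sub>R \<xi>))))
           = (LINT r:{0<..}|lebesgue. f r * (r\<^sup>2 * \<Phi> r))"
    using R(2) by (simp add: \<eta>_def)
qed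

section \<open>Isotropic matrix kernels\<close>

text \<open>Each entry is \<open>\<delta> * b + f * (x $ i * x $ j)\<close> at
  \<open>norm x\<close>, with \<open>f r = (a r - b r) / r^2\<close>, and the product of coordinates
  is a difference of squares (x . v)^2 for v = e_i + e_j and v = e_i - e_j. So it suffices to know
  the quadratic form \<open>Qv\<close>.\<close>

lemma isotropic_fourier_cos:
  fixes \<xi> :: "real ^ 'n" and a b :: "real \<Rightarrow> real" and \<mu> :: real and i j :: 'n
  assumes card: "CARD('n) \<ge> 2" and \<mu>: "\<mu> = real CARD('n) / 2 - 1" and \<xi>: "\<xi> \<noteq> 0"
    and a: "integrable lebesgue (\<lambda>x::real ^ 'n. a (norm x))"
    and b: "integrable lebesgue (\<lambda>x::real ^ 'n. b (norm x))"
  defines "\<rho> \<equiv> norm \<xi>"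
  defines "D \<equiv> LINT r:{0<..}|lebesgue. (a r - b r) * bessel_kernel_1 \<mu> \<rho> r"
  defines "A \<equiv> LINT r:{0<..}|lebesgue. a r * bessel_kernel_0 \<mu> \<rho> r"
  defines "B \<equiv> LINT r:{0<..}|lebesgue. b r * bessel_kernel_0 \<mu> \<rho> r"
  shows "set_integrable lebesgue {0<..} (\<lambda>r. a r * bessel_kernel_0 \<mu> \<rho> r)"
    and "set_integrable lebesgue {0<..} (\<lambda>r. b r * bessel_kernel_0 \<mu> \<rho> r)"
    and "set_integrable lebesgue {0<..} (\<lambda>r. (a r - b r) * bessel_kernel_1 \<mu> \<rho> r)"
    and "(LINT x|lebesgue. (a (norm x) * Pr_par x $ i $ j + b (norm x) * Pr_perp x $ i $ j) * cos (x \<bullet> ((2 * pi) *\<^sub>R \<xi>)))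
       = (A - (2 * \<mu> + 1) * D) * Pr_par \<xi> $ i $ j + (B + D) * Pr_perp \<xi> $ i $ j"
proof -
  have \<mu>': "\<mu> = DIM(real ^ 'n) / 2 - 1" using \<mu> by simp
  have \<rho>: "\<rho> > 0" using \<xi> by (simp add: \<rho>_def)
  note Fa = radial_fourier_cos[OF \<mu>' \<xi> a, folded \<rho>_def]
  note Fb = radial_fourier_cos[OF \<mu>' \<xi> b, folded \<rho>_def]
  show intA: "set_integrable lebesgue {0<..} (\<lambda>r. a r * bessel_kernel_0 \<mu> \<rho> r)" by (rule Fa)
  show intB: "set_integrable lebesgue {0<..} (\<lambda>r. b r * bessel_kernel_0 \<mu> \<rho> r)" by (rule Fb)
  define f where "f r = (a r - b r) / r\<^sup>2" for r
  define w where "w x = cos (x \<bullet> ((2 * pi) *\<^sub>R \<xi>))" for x :: "real ^ 'n"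
  have fm: "(\<lambda>x::real ^ 'n. f (norm x)) \<in> borel_measurable lebesgue"
    unfolding f_def
    by (intro borel_measurable_divide borel_measurable_diff borel_measurable_integrable[OF a]
        borel_measurable_integrable[OF b] measurable_completion) simp
  have ab: "integrable lebesgue (\<lambda>x::real ^ 'n. a (norm x) - b (norm x))"
    using a b by simp
  \<comment> \<open>By Cauchy-Schwarz, (x . v)^2 compensates the division by r^2.\<close>
  have fint: "integrable lebesgue (\<lambda>x. f (norm x) * (x \<bullet> v)\<^sup>2)" for v :: "real ^ 'n"
  proof (rule Bochner_Integration.integrable_bound)
    show "integrable lebesgue (\<lambda>x::real ^ 'n. (norm v)\<^sup>2 * (a (norm x) - b (norm x)))"
      using ab by simp
    show "(\<lambda>x. f (norm x) * (x \<bullet> v)\<^sup>2) \<in> borel_measurable lebesgue"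
      by (intro borel_measurable_times fm measurable_completion) simp
    show "AE x in lebesgue. norm (f (norm x) * (x \<bullet> v)\<^sup>2) \<le> norm ((norm v)\<^sup>2 * (a (norm x) - b (norm x)))"
    proof (rule AE_I2)
      fix x :: "real ^ 'n"
      have "(x \<bullet> v)\<^sup>2 \<le> (norm x)\<^sup>2 * (norm v)\<^sup>2"
        using Cauchy_Schwarz_ineq[of x v] by (simp add: power2_norm_eq_inner)
      then have "\<bar>a (norm x) - b (norm x)\<bar> * (x \<bullet> v)\<^sup>2 \<le> \<bar>a (norm x) - b (norm x)\<bar> * ((norm x)\<^sup>2 * (norm v)\<^sup>2)"
        by (rule mult_left_mono) simp
      then show "norm (f (norm x) * (x \<bullet> v)\<^sup>2) \<le> norm ((norm v)\<^sup>2 * (a (norm x) - b (norm x)))"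
        by (cases "x = 0") (simp_all add: f_def abs_mult pos_divide_le_eq mult_ac)
    qed
  qed
  define \<beta> where "\<beta> v = (v \<bullet> \<xi>)\<^sup>2 / \<rho>\<^sup>2" for v
  note Q = radial_fourier_cos_quadratic[OF \<mu>' \<xi> fm fint, folded \<rho>_def, folded \<beta>_def]
  show intD: "set_integrable lebesgue {0<..} (\<lambda>r. (a r - b r) * bessel_kernel_1 \<mu> \<rho> r)"
  proof -
    \<comment> \<open>A direction orthogonal to \<xi>, which exists in dimension at least 2, makes
      \<beta> vanish and leaves \<open>bessel_kernel_1\<close> alone.\<close>
    obtain v where v: "v \<noteq> 0" "orthogonal \<xi> v"
      using orthogonal_to_vector_exists[of \<xi>] card by auto
    then have \<beta>0: "\<beta> v = 0" by (simp add: \<beta>_def orthogonal_def inner_commute)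
    have "set_integrable lebesgue {0<..} (\<lambda>r. (1 / (norm v)\<^sup>2) * (f r * (r\<^sup>2 * ((norm v)\<^sup>2 * bessel_kernel_1 \<mu> \<rho> r))))"
      using Q(1)[of v] by (intro set_integrable_mult_right) (simp add: \<beta>0)
    then show ?thesis
      by (rule set_integrable_cong[THEN iffD1, rotated -1]) (use v in \<open>auto simp: f_def\<close>)
  qed
  \<comment> \<open>The coefficient of \<open>\<beta> v\<close> in the integrated density, divided
    by \<rho>^2 to make it the coefficient of (v . \<xi>)^2.\<close>
  define C where "C = (A - B - (2 * \<mu> + 2) * D) / \<rho>\<^sup>2"
  have Qv: "(LINT x|lebesgue. f (norm x) * ((x \<bullet> v)\<^sup>2 * w x)) = D * (norm v)\<^sup>2 + C * (v \<bullet> \<xi>)\<^sup>2" for v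
  proof -
    have "(LINT x|lebesgue. f (norm x) * ((x \<bullet> v)\<^sup>2 * w x))
        = (LINT r:{0<..}|lebesgue. ((norm v)\<^sup>2 - (2 * \<mu> + 2) * \<beta> v) * ((a r - b r) * bessel_kernel_1 \<mu> \<rho> r)
            + \<beta> v * (a r * bessel_kernel_0 \<mu> \<rho> r - b r * bessel_kernel_0 \<mu> \<rho> r))"
      unfolding w_def Q(2)
      by (rule set_lebesgue_integral_cong) (auto simp: f_def field_simps)
    also have "\<dots> = (LINT r:{0<..}|lebesgue. ((norm v)\<^sup>2 - (2 * \<mu> + 2) * \<beta> v) * ((a r - b r) * bessel_kernel_1 \<mu> \<rho> r))
          + (LINT r:{0<..}|lebesgue. \<beta> v * (a r * bessel_kernel_0 \<mu> \<rho> r - b r * bessel_kernel_0 \<mu> \<rho> r))"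
      by (intro set_integral_add(2) set_integrable_mult_right set_integral_diff(1) intA intB intD)
    also have "\<dots> = ((norm v)\<^sup>2 - (2 * \<mu> + 2) * \<beta> v) * D + \<beta> v * (A - B)"
      using set_integral_diff(2)[OF intA intB] by (simp add: A_def B_def D_def)
    also have "\<dots> = D * (norm v)\<^sup>2 + C * (v \<bullet> \<xi>)\<^sup>2"
      using \<rho> by (simp add: \<beta>_def C_def field_simps)
    finally show ?thesis .
  qed
  let ?p = "axis i (1::real) + axis j 1 :: real ^ 'n" and ?q = "axis i (1::real) - axis j 1 :: real ^ 'n"
  have pq: "x $ i * x $ j = ((x \<bullet> ?p)\<^sup>2 - (x \<bullet> ?q)\<^sup>2) / 4" for x
    by (simp add: inner_simps inner_axis power2_eq_square algebra_simps)
  have wm: "w \<in> borel_measurable lebesgue"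
    unfolding w_def[abs_def] by (intro measurable_completion) simp
  have w1: "\<bar>w x\<bar> \<le> 1" for x by (simp add: w_def)
  have fwint: "integrable lebesgue (\<lambda>x. f (norm x) * ((x \<bullet> v)\<^sup>2 * w x))" for v
  proof (rule Bochner_Integration.integrable_bound[OF fint[of v]])
    show "(\<lambda>x. f (norm x) * ((x \<bullet> v)\<^sup>2 * w x)) \<in> borel_measurable lebesgue"
      by (intro borel_measurable_times fm wm measurable_completion) simp
    show "AE x in lebesgue. norm (f (norm x) * ((x \<bullet> v)\<^sup>2 * w x)) \<le> norm (f (norm x) * (x \<bullet> v)\<^sup>2)"
      using w1 by (intro AE_I2) (simp add: abs_mult mult_left_le mult_le_cancel_left1 mult_left_mono)
  qed
  have bwint: "integrable lebesgue (\<lambda>x. b (norm x) * w x)"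
  proof (rule Bochner_Integration.integrable_bound[OF b])
    show "(\<lambda>x. b (norm x) * w x) \<in> borel_measurable lebesgue"
      by (intro borel_measurable_times wm borel_measurable_integrable[OF b])
    show "AE x in lebesgue. norm (b (norm x) * w x) \<le> norm (b (norm x))"
      using w1 by (intro AE_I2) (simp add: abs_mult mult_left_le)
  qed
  define \<delta> where "\<delta> = (mat 1 :: real ^ 'n ^ 'n) $ i $ j"
  have "(LINT x|lebesgue. (a (norm x) * Pr_par x $ i $ j + b (norm x) * Pr_perp x $ i $ j) * w x)
      = (LINT x|lebesgue. \<delta> * (b (norm x) * w x)
          + (1 / 4) * (f (norm x) * ((x \<bullet> ?p)\<^sup>2 * w x) - f (norm x) * ((x \<bullet> ?q)\<^sup>2 * w x)))"
  proof (rule Bochner_Integration.integral_cong[OF refl])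
    fix x :: "real ^ 'n"
    have "a (norm x) * Pr_par x $ i $ j + b (norm x) * Pr_perp x $ i $ j
        = \<delta> * b (norm x) + f (norm x) * (x $ i * x $ j)"
      by (simp add: Pr_perp_def Pr_par_def \<delta>_def f_def algebra_simps diff_divide_distrib)
    moreover have "(\<delta> * s + t * ((P - Q) / 4)) * w x = \<delta> * (s * w x) + (1 / 4) * (t * (P * w x) - t * (Q * w x))" for s t P Q
      by (simp add: algebra_simps diff_divide_distrib)
    ultimately show "(a (norm x) * Pr_par x $ i $ j + b (norm x) * Pr_perp x $ i $ j) * w x = \<delta> * (b (norm x) * w x)
          + (1 / 4) * (f (norm x) * ((x \<bullet> ?p)\<^sup>2 * w x) - f (norm x) * ((x \<bullet> ?q)\<^sup>2 * w x))"
      by (simp only: pq)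
  qed
  also have "\<dots> = \<delta> * B + (1 / 4) * ((D * (norm ?p)\<^sup>2 + C * (?p \<bullet> \<xi>)\<^sup>2) - (D * (norm ?q)\<^sup>2 + C * (?q \<bullet> \<xi>)\<^sup>2))"
  proof -
    have "(LINT x|lebesgue. b (norm x) * w x) = B"
      using Fb(2) by (simp only: w_def B_def)
    then show ?thesis
      using fwint bwint by (simp add: Qv)
  qed
  also have "\<dots> = \<delta> * (B + D) + C * (\<xi> $ i * \<xi> $ j)"
  proof -
    have "(norm ?p)\<^sup>2 - (norm ?q)\<^sup>2 = 4 * \<delta>"
      by (simp add: power2_norm_eq_inner inner_simps inner_axis_axis \<delta>_def mat_def inner_commute)
    moreover have "(?p \<bullet> \<xi>)\<^sup>2 - (?q \<bullet> \<xi>)\<^sup>2 = 4 * (\<xi> $ i * \<xi> $ j)"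
      unfolding pq by (simp add: inner_commute)
    moreover have "(1 / 4) * ((D * (norm ?p)\<^sup>2 + C * (?p \<bullet> \<xi>)\<^sup>2) - (D * (norm ?q)\<^sup>2 + C * (?q \<bullet> \<xi>)\<^sup>2))
        = (1 / 4) * (D * ((norm ?p)\<^sup>2 - (norm ?q)\<^sup>2) + C * ((?p \<bullet> \<xi>)\<^sup>2 - (?q \<bullet> \<xi>)\<^sup>2))"
    proof -
      have "(1 / 4) * ((D * P + C * P') - (D * Q + C * Q')) = (1 / 4) * (D * (P - Q) + C * (P' - Q'))" for P P' Q Q'
        by (simp add: algebra_simps)
      then show ?thesis .
    qed
    ultimately show ?thesis by (simp add: algebra_simps)
  qed
  \<comment> \<open>Along \<xi>, \<open>C\<close> adds A - B - (2 \<mu> + 2) D to the isotropic B +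
    D; this is where 2 \<mu> + 1 comes from.\<close>
  also have "\<dots> = (A - (2 * \<mu> + 1) * D) * Pr_par \<xi> $ i $ j + (B + D) * Pr_perp \<xi> $ i $ j"
    using \<rho> by (simp add: Pr_perp_def Pr_par_def \<delta>_def C_def \<rho>_def field_simps)
  finally show "(LINT x|lebesgue. (a (norm x) * Pr_par x $ i $ j + b (norm x) * Pr_perp x $ i $ j) * cos (x \<bullet> ((2 * pi) *\<^sub>R \<xi>)))
       = (A - (2 * \<mu> + 1) * D) * Pr_par \<xi> $ i $ j + (B + D) * Pr_perp \<xi> $ i $ j"
    unfolding w_def .
qed

section \<open>Even kernels and the matrix transform\<close>

lemma integral_odd_eq_0:
  fixes f :: "'a::euclidean_space \<Rightarrow> real"
  assumes f: "f \<in> borel_measurable lebesgue" and odd: "\<And>x. f (- x) = - f x"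
  shows "(LINT x|lebesgue. f x) = 0"
proof -
  \<comment> \<open>Reflection is the affine map with factor -1 in every coordinate, whose Jacobian
    has modulus 1.\<close>
  have T: "(\<lambda>x::'a. 0 + (\<Sum>j\<in>Basis. (- 1 * (x \<bullet> j)) *\<^sub>R j)) = uminus"
    by (simp add: fun_eq_iff sum_negf euclidean_representation)
  have L: "lebesgue = density (distr lebesgue lebesgue (uminus :: 'a \<Rightarrow> 'a)) (\<lambda>_. 1)"
    using lebesgue_affine_euclidean[of "\<lambda>_. - 1" "0::'a"] unfolding T by simp
  have M: "(uminus :: 'a \<Rightarrow> 'a) \<in> lebesgue \<rightarrow>\<^sub>M lebesgue"
    using lebesgue_affine_measurable[of "\<lambda>_. - 1" "0::'a"] unfolding T by simp
  have "(LINT x|lebesgue. f x) = (LINT x|distr lebesgue lebesgue uminus. f x)"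
    by (subst L) (simp add: density_1)
  also have "\<dots> = (LINT x|lebesgue. f (- x))"
    using M f by (rule integral_distr)
  also have "\<dots> = - (LINT x|lebesgue. f x)"
    by (simp add: odd)
  finally show ?thesis by simp
qed

text \<open>Against an even function the sine part of the exponential is odd and integrates to 0.
  Matrix entries qualify, depending on \<open>x\<close> through \<open>norm x\<close> and products
  of two coordinates; hence the transform is real.\<close>

lemma fourier_even_real:
  fixes M :: "real ^ 'n \<Rightarrow> real"
  assumes M: "integrable lebesgue M" and even: "\<And>x. M (- x) = M x"
  shows "fourier (\<lambda>x. complex_of_real (M x)) \<xi>
     = complex_of_real (LINT x|lebesgue. M x * cos (x \<bullet> ((2 * pi) *\<^sub>R \<xi>)))"
proof -
  define \<eta> where "\<eta> = (2 * pi) *\<^sub>R \<xi>"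
  have meas: "(\<lambda>x. M x * g (x \<bullet> \<eta>)) \<in> borel_measurable lebesgue"
    if "continuous_on UNIV g" for g :: "real \<Rightarrow> real"
  proof -
    have [measurable]: "g \<in> borel_measurable borel" using that by (rule borel_measurable_continuous_onI)
    show ?thesis
      by (intro borel_measurable_times borel_measurable_integrable[OF M] measurable_completion) simp
  qed
  have c: "integrable lebesgue (\<lambda>x. M x * cos (x \<bullet> \<eta>))"
    by (rule Bochner_Integration.integrable_bound[OF M meas])
       (auto intro!: continuous_intros AE_I2 simp: abs_mult mult_left_le)
  have s: "integrable lebesgue (\<lambda>x. M x * sin (x \<bullet> \<eta>))"
    by (rule Bochner_Integration.integrable_bound[OF M meas])
       (auto intro!: continuous_intros AE_I2 simp: abs_mult mult_left_le)
  have "complex_of_real (M x) * exp (- 2 * complex_of_real pi * \<i> * complex_of_real (x \<bullet> \<xi>))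
      = complex_of_real (M x * cos (x \<bullet> \<eta>)) - \<i> * complex_of_real (M x * sin (x \<bullet> \<eta>))" for x
  proof -
    have "- 2 * complex_of_real pi * \<i> * complex_of_real (x \<bullet> \<xi>) = \<i> * complex_of_real (- (x \<bullet> \<eta>))"
      by (simp add: \<eta>_def)
    then have "exp (- 2 * complex_of_real pi * \<i> * complex_of_real (x \<bullet> \<xi>)) = cis (- (x \<bullet> \<eta>))"
      by (simp only: cis_conv_exp)
    then show ?thesis
      by (simp add: cis.ctr complex_eq_iff)
  qed
  then have "fourier (\<lambda>x. complex_of_real (M x)) \<xi>
      = (LINT x|lebesgue. complex_of_real (M x * cos (x \<bullet> \<eta>)) - \<i> * complex_of_real (M x * sin (x \<bullet> \<eta>)))"
    by (simp add: fourier_def)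
  also have "\<dots> = complex_of_real (LINT x|lebesgue. M x * cos (x \<bullet> \<eta>)) - \<i> * complex_of_real (LINT x|lebesgue. M x * sin (x \<bullet> \<eta>))"
    using c s by (subst Bochner_Integration.integral_diff)
      (auto simp del: of_real_mult intro!: integrable_of_real)
  also have "(LINT x|lebesgue. M x * sin (x \<bullet> \<eta>)) = 0"
    by (rule integral_odd_eq_0) (auto intro!: meas continuous_intros simp: even)
  finally show ?thesis by (simp add: \<eta>_def)
qed

text \<open>Integrability stands in the conclusion because the integral of a non-integrable function
  is 0 by convention; it makes the integrals in the formulas for \<open>h_par\<close> and
  \<open>h_perp\<close> genuine ones.\<close>

theorem theorem3p11:
  fixes K :: "real ^ 'n \<Rightarrow> real ^ 'n ^ 'n"
    and k_par k_perp h_par h_perp :: "real \<Rightarrow> real"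
    and \<mu> :: real
  assumes "CARD('n) \<ge> 2"
    and "integrable lebesgue K"
    and "\<And>x. x \<noteq> 0 \<Longrightarrow> K x = k_par (norm x) *\<^sub>R Pr_par x + k_perp (norm x) *\<^sub>R Pr_perp x"
    and "\<mu> = real CARD('n) / 2 - 1"
    and "\<And>\<rho>. \<rho> > 0 \<Longrightarrow> h_par \<rho> =
        2 * pi / \<rho> powr \<mu> *
          (LINT r:{0<..}|lebesgue. r powr (\<mu> + 1) * k_par r * bessel_J \<mu> (2 * pi * \<rho> * r))
        - (2 * \<mu> + 1) / \<rho> powr (\<mu> + 1) *
          (LINT r:{0<..}|lebesgue. r powr \<mu> * (k_par r - k_perp r) * bessel_J (\<mu> + 1) (2 * pi * \<rho> * r))"
    and "\<And>\<rho>. \<rho> > 0 \<Longrightarrow> h_perp \<rho> =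
        2 * pi / \<rho> powr \<mu> *
          (LINT r:{0<..}|lebesgue. r powr (\<mu> + 1) * k_perp r * bessel_J \<mu> (2 * pi * \<rho> * r))
        + 1 / \<rho> powr (\<mu> + 1) *
          (LINT r:{0<..}|lebesgue. r powr \<mu> * (k_par r - k_perp r) * bessel_J (\<mu> + 1) (2 * pi * \<rho> * r))"
  shows "(\<forall>\<rho>>0.
            set_integrable lebesgue {0<..} (\<lambda>r. r powr (\<mu> + 1) * k_par r * bessel_J \<mu> (2 * pi * \<rho> * r)) \<and>
            set_integrable lebesgue {0<..} (\<lambda>r. r powr (\<mu> + 1) * k_perp r * bessel_J \<mu> (2 * pi * \<rho> * r)) \<and>
            set_integrable lebesgue {0<..}
              (\<lambda>r. r powr \<mu> * (k_par r - k_perp r) * bessel_J (\<mu> + 1) (2 * pi * \<rho> * r))) \<and>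
         (\<forall>\<xi> :: real ^ 'n. \<xi> \<noteq> 0 \<longrightarrow>
            fourier_matrix K \<xi> =
              complex_matrix (h_par (norm \<xi>) *\<^sub>R Pr_par \<xi> + h_perp (norm \<xi>) *\<^sub>R Pr_perp \<xi>))"
proof -
  \<comment> \<open>\<open>K 0\<close>, \<open>k_par 0\<close> and \<open>k_perp 0\<close> are unconstrained; set to 0, the isotropic form holds at 0 as well.\<close>
  define a where "a r = (if r = 0 then 0 else k_par r)" for r
  define b where "b r = (if r = 0 then 0 else k_perp r)" for r
  define K' where "K' x = (if x = 0 then 0 else K x)" for x
  have AE: "AE x in lebesgue. K' x = K x"
    using AE_completion[OF AE_lborel_singleton[of "0 :: real ^ 'n"]]
    by eventually_elim (simp add: K'_def)
  have "(\<lambda>x. if x \<in> {0} then 0 else K x) \<in> borel_measurable lebesgue"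
    using assms(2) by (intro measurable_If_set) auto
  then have K'_meas: "K' \<in> borel_measurable lebesgue"
    by (simp add: K'_def[abs_def])
  then have K'_int: "integrable lebesgue K'"
    using integrable_cong_AE[of K lebesgue K'] assms(2) AE by (auto simp: eq_commute)
  have K'_entry: "integrable lebesgue (\<lambda>x. K' x $ i $ j)" for i j
    using integrable_bounded_linear[OF bounded_linear_vec_nth integrable_bounded_linear[OF bounded_linear_vec_nth K'_int]] .
  have K'_eq: "K' x $ i $ j = a (norm x) * Pr_par x $ i $ j + b (norm x) * Pr_perp x $ i $ j" for x i j
    using assms(3)[of x] by (simp add: K'_def a_def b_def)
  have norm_sq: "(\<Sum>i\<in>UNIV. x $ i * x $ i) = (norm x)\<^sup>2" for x :: "real ^ 'n"
    by (simp add: power2_norm_eq_inner inner_vec_def)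
  have P_trace: "(\<Sum>i\<in>UNIV. Pr_par x $ i $ i) = 1" if "x \<noteq> 0" for x :: "real ^ 'n"
    using that norm_sq[of x] by (simp add: Pr_par_def sum_divide_distrib[symmetric])
  have P_sq: "(\<Sum>i\<in>UNIV. \<Sum>j\<in>UNIV. Pr_par x $ i $ j * Pr_par x $ i $ j) = 1" if "x \<noteq> 0" for x :: "real ^ 'n"
  proof -
    have "(\<Sum>i\<in>UNIV. \<Sum>j\<in>UNIV. Pr_par x $ i $ j * Pr_par x $ i $ j)
        = (\<Sum>i\<in>UNIV. \<Sum>j\<in>UNIV. Pr_par x $ i $ i * Pr_par x $ j $ j)"
      by (simp add: Pr_par_def mult_ac)
    also have "\<dots> = (\<Sum>i\<in>UNIV. Pr_par x $ i $ i) * (\<Sum>j\<in>UNIV. Pr_par x $ j $ j)"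
      by (simp add: sum_product)
    finally show ?thesis using P_trace[OF that] by simp
  qed
  \<comment> \<open>Division by 0 gives 0 here, in accordance with \<open>a 0 = 0\<close>; the next
    identity thus holds at every \<open>x\<close>.\<close>
  have P0: "Pr_par (0 :: real ^ 'n) $ i $ j = 0" for i j
    by (simp add: Pr_par_def)
  \<comment> \<open>For \<open>x\<close> not 0, \<open>Pr_par x\<close> is a rank-one projection:
    its trace and its sum of squared entries are 1, so pairing it with \<open>K'\<close> returns
    \<open>a\<close>. Its entries are bounded, so integrability passes from \<open>K'\<close> to
    \<open>a\<close>.\<close>
  have a_eq: "a (norm x) = (\<Sum>i\<in>UNIV. \<Sum>j\<in>UNIV. Pr_par x $ i $ j * K' x $ i $ j)" for x
  proof (cases "x = 0")
    case True
    then show ?thesis by (simp add: a_def P0)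
  next
    case False
    have "(\<Sum>i\<in>UNIV. \<Sum>j\<in>UNIV. Pr_par x $ i $ j * K' x $ i $ j)
        = (\<Sum>i\<in>UNIV. \<Sum>j\<in>UNIV. (a (norm x) - b (norm x)) * (Pr_par x $ i $ j * Pr_par x $ i $ j)
            + b (norm x) * (if i = j then Pr_par x $ i $ j else 0))"
      by (intro sum.cong refl) (simp add: K'_eq Pr_perp_def mat_def algebra_simps)
    also have "\<dots> = (a (norm x) - b (norm x)) * (\<Sum>i\<in>UNIV. \<Sum>j\<in>UNIV. Pr_par x $ i $ j * Pr_par x $ i $ j)
        + b (norm x) * (\<Sum>i\<in>UNIV. Pr_par x $ i $ i)"
      by (simp add: sum.distrib sum_distrib_left if_distrib[of "(*) _"] cong: if_cong)
    finally show ?thesis using P_sq[OF False] P_trace[OF False] by simp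
  qed
  \<comment> \<open>The trace contains \<open>b\<close> with multiplicity d - 1, which is nonzero,
    so \<open>b\<close> is recovered once \<open>a\<close> is.\<close>
  have trace: "(\<Sum>i\<in>UNIV. K' x $ i $ i) = a (norm x) + (real CARD('n) - 1) * b (norm x)" for x
  proof (cases "x = 0")
    case True
    then show ?thesis by (simp add: a_def b_def K'_def)
  next
    case False
    have "(\<Sum>i\<in>UNIV. K' x $ i $ i) = (\<Sum>i\<in>UNIV. (a (norm x) - b (norm x)) * Pr_par x $ i $ i + b (norm x))"
      by (intro sum.cong refl) (simp add: K'_eq Pr_perp_def mat_def algebra_simps)
    also have "\<dots> = (a (norm x) - b (norm x)) * (\<Sum>i\<in>UNIV. Pr_par x $ i $ i) + real CARD('n) * b (norm x)"
      by (simp add: sum.distrib sum_distrib_left)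
    finally show ?thesis using P_trace[OF False] by (simp add: algebra_simps)
  qed
  have a_int: "integrable lebesgue (\<lambda>x::real ^ 'n. a (norm x))"
    unfolding a_eq
  proof (intro Bochner_Integration.integrable_sum)
    fix i j
    have "\<bar>Pr_par x $ i $ j\<bar> \<le> 1" for x :: "real ^ 'n"
    proof -
      have "\<bar>x $ i\<bar> * \<bar>x $ j\<bar> \<le> norm x * norm x"
        by (intro mult_mono component_le_norm_cart) auto
      then show ?thesis
        by (cases "x = 0") (simp_all add: Pr_par_def abs_mult power2_eq_square)
    qed
    moreover have "(\<lambda>x. Pr_par x $ i $ j * K' x $ i $ j) \<in> borel_measurable lebesgue"
      unfolding Pr_par_def vec_lambda_beta
      by (intro borel_measurable_times borel_measurable_integrable[OF K'_entry] measurable_completion) simp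
    ultimately show "integrable lebesgue (\<lambda>x. Pr_par x $ i $ j * K' x $ i $ j)"
      by (intro Bochner_Integration.integrable_bound[OF K'_entry[of i j]] AE_I2) (auto simp: abs_mult mult_left_le_one_le)
  qed
  have b_int: "integrable lebesgue (\<lambda>x::real ^ 'n. b (norm x))"
  proof -
    have "b (norm x) = ((\<Sum>i\<in>UNIV. K' x $ i $ i) - a (norm x)) / (real CARD('n) - 1)" for x :: "real ^ 'n"
      using trace[of x] assms(1) by (simp add: field_simps)
    then show ?thesis
      using K'_entry a_int by simp
  qed
  define D where "D \<rho> = (LINT r:{0<..}|lebesgue. (a r - b r) * bessel_kernel_1 \<mu> \<rho> r)" for \<rho>
  define A where "A \<rho> = (LINT r:{0<..}|lebesgue. a r * bessel_kernel_0 \<mu> \<rho> r)" for \<rho>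
  define B where "B \<rho> = (LINT r:{0<..}|lebesgue. b r * bessel_kernel_0 \<mu> \<rho> r)" for \<rho>
  note F = isotropic_fourier_cos[OF assms(1,4) _ a_int b_int, folded A_def B_def D_def]
  have k0: "f r * bessel_kernel_0 \<mu> \<rho> r = 2 * pi / \<rho> powr \<mu> * (r powr (\<mu> + 1) * f r * bessel_J \<mu> (2 * pi * \<rho> * r))" for f :: "real \<Rightarrow> real" and \<rho> r
    by (simp add: bessel_kernel_0_def)
  have k1: "f r * bessel_kernel_1 \<mu> \<rho> r = 1 / \<rho> powr (\<mu> + 1) * (r powr \<mu> * f r * bessel_J (\<mu> + 1) (2 * pi * \<rho> * r))" for f :: "real \<Rightarrow> real" and \<rho> r
    by (simp add: bessel_kernel_1_def)
  have "set_integrable lebesgue {0<..} (\<lambda>r. r powr (\<mu> + 1) * k_par r * bessel_J \<mu> (2 * pi * \<rho> * r)) \<and>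
      set_integrable lebesgue {0<..} (\<lambda>r. r powr (\<mu> + 1) * k_perp r * bessel_J \<mu> (2 * pi * \<rho> * r)) \<and>
      set_integrable lebesgue {0<..} (\<lambda>r. r powr \<mu> * (k_par r - k_perp r) * bessel_J (\<mu> + 1) (2 * pi * \<rho> * r))"
    if \<rho>: "\<rho> > 0" for \<rho>
  proof -
    \<comment> \<open>The integrands depend on \<rho> only; any vector of this length gives access
      to the integrability results.\<close>
    obtain \<xi> :: "real ^ 'n" where \<xi>: "norm \<xi> = \<rho>"
      using \<rho> vector_choose_size[of \<rho>] by auto
    then have \<xi>0: "\<xi> \<noteq> 0" using \<rho> by auto
    note I = F(1-3)[OF \<xi>0, unfolded \<xi>]
    \<comment> \<open>The inverse prefactors undo the normalisation built into the kernels.\<close>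
    have "set_integrable lebesgue {0<..} (\<lambda>r. \<rho> powr \<mu> / (2 * pi) * (a r * bessel_kernel_0 \<mu> \<rho> r))"
      "set_integrable lebesgue {0<..} (\<lambda>r. \<rho> powr \<mu> / (2 * pi) * (b r * bessel_kernel_0 \<mu> \<rho> r))"
      "set_integrable lebesgue {0<..} (\<lambda>r. \<rho> powr (\<mu> + 1) * ((a r - b r) * bessel_kernel_1 \<mu> \<rho> r))"
      using I by (auto intro: set_integrable_mult_right)
    moreover have "set_integrable lebesgue {0<..} (\<lambda>r. \<rho> powr \<mu> / (2 * pi) * (a r * bessel_kernel_0 \<mu> \<rho> r))
       \<longleftrightarrow> set_integrable lebesgue {0<..} (\<lambda>r. r powr (\<mu> + 1) * k_par r * bessel_J \<mu> (2 * pi * \<rho> * r))"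
      using \<rho> by (intro set_integrable_cong) (auto simp: k0 a_def)
    moreover have "set_integrable lebesgue {0<..} (\<lambda>r. \<rho> powr \<mu> / (2 * pi) * (b r * bessel_kernel_0 \<mu> \<rho> r))
       \<longleftrightarrow> set_integrable lebesgue {0<..} (\<lambda>r. r powr (\<mu> + 1) * k_perp r * bessel_J \<mu> (2 * pi * \<rho> * r))"
      using \<rho> by (intro set_integrable_cong) (auto simp: k0 b_def)
    moreover have "set_integrable lebesgue {0<..} (\<lambda>r. \<rho> powr (\<mu> + 1) * ((a r - b r) * bessel_kernel_1 \<mu> \<rho> r))
       \<longleftrightarrow> set_integrable lebesgue {0<..} (\<lambda>r. r powr \<mu> * (k_par r - k_perp r) * bessel_J (\<mu> + 1) (2 * pi * \<rho> * r))"
      using \<rho> by (intro set_integrable_cong) (auto simp: bessel_kernel_1_def a_def b_def)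
    ultimately show ?thesis by simp
  qed
  moreover have "fourier_matrix K \<xi> = complex_matrix (h_par (norm \<xi>) *\<^sub>R Pr_par \<xi> + h_perp (norm \<xi>) *\<^sub>R Pr_perp \<xi>)"
    if \<xi>: "\<xi> \<noteq> 0" for \<xi>
  proof -
    define \<rho> where "\<rho> = norm \<xi>"
    have \<rho>: "\<rho> > 0" using \<xi> by (simp add: \<rho>_def)
    have A: "A \<rho> = 2 * pi / \<rho> powr \<mu> * (LINT r:{0<..}|lebesgue. r powr (\<mu> + 1) * k_par r * bessel_J \<mu> (2 * pi * \<rho> * r))"
      unfolding A_def k0 set_integral_mult_right
      by (intro arg_cong2[where f = "(*)"] refl set_lebesgue_integral_cong) (auto simp: a_def)
    have B: "B \<rho> = 2 * pi / \<rho> powr \<mu> * (LINT r:{0<..}|lebesgue. r powr (\<mu> + 1) * k_perp r * bessel_J \<mu> (2 * pi * \<rho> * r))"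
      unfolding B_def k0 set_integral_mult_right
      by (intro arg_cong2[where f = "(*)"] refl set_lebesgue_integral_cong) (auto simp: b_def)
    have D: "D \<rho> = 1 / \<rho> powr (\<mu> + 1) * (LINT r:{0<..}|lebesgue. r powr \<mu> * (k_par r - k_perp r) * bessel_J (\<mu> + 1) (2 * pi * \<rho> * r))"
      unfolding D_def k1[of "\<lambda>r. a r - b r"] set_integral_mult_right
      by (intro arg_cong2[where f = "(*)"] refl set_lebesgue_integral_cong) (auto simp: a_def b_def)
    have h: "h_par \<rho> = A \<rho> - (2 * \<mu> + 1) * D \<rho>" "h_perp \<rho> = B \<rho> + D \<rho>"
      unfolding assms(5)[OF \<rho>] assms(6)[OF \<rho>] A B D by simp_all
    have "fourier (\<lambda>x. complex_of_real (K x $ i $ j)) \<xi>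
        = complex_of_real (h_par \<rho> * Pr_par \<xi> $ i $ j + h_perp \<rho> * Pr_perp \<xi> $ i $ j)" for i j
    proof -
      \<comment> \<open>The change at the origin does not affect the integral.\<close>
      have "fourier (\<lambda>x. complex_of_real (K x $ i $ j)) \<xi> = fourier (\<lambda>x. complex_of_real (K' x $ i $ j)) \<xi>"
        unfolding fourier_def
      proof (rule integral_cong_AE)
        have "(\<lambda>x. exp (- 2 * complex_of_real pi * \<i> * complex_of_real (x \<bullet> \<xi>))) \<in> borel_measurable borel"
          by (intro borel_measurable_continuous_onI continuous_intros)
        then have E: "(\<lambda>x. exp (- 2 * complex_of_real pi * \<i> * complex_of_real (x \<bullet> \<xi>))) \<in> borel_measurable lebesgue"
          by (intro measurable_completion) simp
        have K_entry: "integrable lebesgue (\<lambda>x. K x $ i $ j)"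
          using integrable_bounded_linear[OF bounded_linear_vec_nth integrable_bounded_linear[OF bounded_linear_vec_nth assms(2)]] .
        show "(\<lambda>x. complex_of_real (K x $ i $ j) * exp (- 2 * complex_of_real pi * \<i> * complex_of_real (x \<bullet> \<xi>))) \<in> borel_measurable lebesgue"
          by (intro borel_measurable_times E borel_measurable_integrable[OF integrable_of_real[OF K_entry]])
        show "(\<lambda>x. complex_of_real (K' x $ i $ j) * exp (- 2 * complex_of_real pi * \<i> * complex_of_real (x \<bullet> \<xi>))) \<in> borel_measurable lebesgue"
          by (intro borel_measurable_times E borel_measurable_integrable[OF integrable_of_real[OF K'_entry]])
        show "AE x in lebesgue. complex_of_real (K x $ i $ j) * exp (- 2 * complex_of_real pi * \<i> * complex_of_real (x \<bullet> \<xi>))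
            = complex_of_real (K' x $ i $ j) * exp (- 2 * complex_of_real pi * \<i> * complex_of_real (x \<bullet> \<xi>))"
          using AE by eventually_elim simp
      qed
      also have "\<dots> = complex_of_real (LINT x|lebesgue. K' x $ i $ j * cos (x \<bullet> ((2 * pi) *\<^sub>R \<xi>)))"
        by (rule fourier_even_real[OF K'_entry]) (simp add: K'_eq Pr_perp_def Pr_par_def)
      also have "(LINT x|lebesgue. K' x $ i $ j * cos (x \<bullet> ((2 * pi) *\<^sub>R \<xi>))) = h_par \<rho> * Pr_par \<xi> $ i $ j + h_perp \<rho> * Pr_perp \<xi> $ i $ j"
        unfolding K'_eq F(4)[OF \<xi>] h[unfolded \<rho>_def] \<rho>_def ..
      finally show ?thesis .
    qed
    then show ?thesis
      by (simp add: fourier_matrix_def complex_matrix_def \<rho>_def vec_eq_iff)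
  qed
  ultimately show ?thesis by blast
qed

end
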